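(* Let $n\ge 3$ and let $z_k=x_k+iy_k$ ($k=1,\ldots,n$) be points of the closed unit disc $\{z\in\mathbb{C}:|z|\le 1\}$ which are the positively oriented (listed counterclockwise along the boundary) vertices of a hyperbolic $n$-gon in the Poincaré disc model (vertices on the unit circle being allowed), consecutive vertices being distinct. Put $z_{n+1}=z_1$, i.e. $(x_{n+1},y_{n+1})=(x_1,y_1)$. Let $A$ be the hyperbolic area of the $n$-gon. Then: (i) if the $n$-gon has $l$ inward sides, whose circular arcs have (Euclidean) angle measures $\alpha_1,\ldots,\alpha_l$, and $m$ outward sides, whose circular arcs have (Euclidean) angle measures $\beta_1,\ldots,\beta_m$ (so $l+m=n$), then $$A=\sum_{k=1}^{l}\alpha_k-\sum_{k=1}^{m}\beta_k;$$ (ii) $$A=\sum_{k=1}^n 2\,\mathrm{Tan}^{-1}\left(\frac{x_k y_{k+1}-y_k x_{k+1}}{1-x_k x_{k+1}-y_k y_{k+1}}\right).$$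
   Context: The Poincaré disc model is the unit disc with the conformal metric $\frac{2}{1-|z|^2}|dz|$. The hyperbolic area of a region $\mathcal{R}$ in the disc is $\iint_{\mathcal{R}}\left(\frac{2}{1-x^2-y^2}\right)^2 dx\,dy$. The geodesic joining two distinct points of the closed disc (possibly on the unit circle) is the arc between them, inside the disc, of the circle through them meeting the unit circle at right angles, or a Euclidean segment of a diameter. A hyperbolic $n$-gon with vertices $z_1,\ldots,z_n$ is the region bounded by the closed curve consisting of the geodesics from $z_k$ to $z_{k+1}$ (with $z_{n+1}=z_1$), where this closed curve is assumed to be a Jordan curve. It is a known fact that its area is $\pi(n-2)-\sum_{k=1}^n\theta_k$, where $\theta_k$ is the interior angle at the $k$-th vertex (interior angles at vertices on the unit circle are also allowed). A side is inward if it is concave with respect to the interior of the $n$-gon in the Euclidean sense: it is a genuine circular arc and, near the relative interior of the arc, the $n$-gon's interior lies on the side of the arc outside the circle containing the arc. A side is outward if it is convex with respect to the interior of the $n$-gon in the Euclidean sense: near the relative interior of the arc, the $n$-gon's interior lies inside the circle containing the arc. A side that is a Euclidean line segment counts as outward. The angle measure of a side is the central angle in $[0,\pi]$ subtended by the arc in the Euclidean circle containing it; it is $0$ for a Euclidean line segment. $\mathrm{Tan}^{-1}$ is the principal arctangent, with values in $(-\pi/2,\pi/2)$. *)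

theory Defs
  imports "HOL-Complex_Analysis.Complex_Analysis"
begin

definition hyperbolic_density :: "complex \<Rightarrow> real" where
  "hyperbolic_density z = (2 / (1 - (Re z)\<^sup>2 - (Im z)\<^sup>2))\<^sup>2"

definition hyperbolic_area :: "complex set \<Rightarrow> real" where
  "hyperbolic_area R = (LINT z:R|lborel. hyperbolic_density z)"

text \<open>The radii to a common point are normal to the two circles there, so the circles
  are perpendicular at that point iff the radii are.\<close>

definition orthogonal_to_unit_circle :: "complex \<Rightarrow> real \<Rightarrow> bool" where
  "orthogonal_to_unit_circle c r \<longleftrightarrow>
     0 < r \<and> sphere c r \<inter> sphere 0 1 \<noteq> {} \<and>
     (\<forall>w \<in> sphere c r \<inter> sphere 0 1. orthogonal (w - c) w)"

text \<open>\<open>Segment p q\<close> is the Euclidean segment from \<open>p\<close> to \<open>q\<close>; \<open>Arc c r s t\<close> is the part of the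
  circle with centre \<open>c\<close> and radius \<open>r\<close> traversed from polar angle \<open>s\<close> to polar angle \<open>t\<close>
  (counterclockwise if \<open>s < t\<close>, clockwise if \<open>t < s\<close>).\<close>

datatype side = Segment complex complex | Arc complex real real real

primrec side_path :: "side \<Rightarrow> real \<Rightarrow> complex" where
  "side_path (Segment p q) = linepath p q"
| "side_path (Arc c r s t) = part_circlepath c r s t"

text \<open>The condition \<open>path_image \<dots> \<subseteq> cball 0 1\<close> selects, of the two arcs of the circle between
  \<open>p\<close> and \<open>q\<close>, the one inside the disc, and excludes any winding around the circle. Hence for
  distinct \<open>p\<close>, \<open>q\<close> in the closed disc the geodesic is unique, up to adding a common
  multiple of \<open>2 * pi\<close> to \<open>s\<close> and \<open>t\<close>. Collinearity of \<open>0\<close>, \<open>p\<close>, \<open>q\<close> says that \<open>p\<close> and \<open>q\<close> lie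
  on a common diameter.\<close>

primrec is_geodesic :: "side \<Rightarrow> complex \<Rightarrow> complex \<Rightarrow> bool" where
  "is_geodesic (Segment a b) p q \<longleftrightarrow> a = p \<and> b = q \<and> collinear {0, p, q}"
| "is_geodesic (Arc c r s t) p q \<longleftrightarrow>
     orthogonal_to_unit_circle c r \<and>
     pathstart (part_circlepath c r s t) = p \<and>
     pathfinish (part_circlepath c r s t) = q \<and>
     path_image (part_circlepath c r s t) \<subseteq> cball 0 1"

text \<open>For an arc that is a geodesic, \<open>\<bar>t - s\<bar> < pi\<close> automatically.\<close>

primrec angle_measure :: "side \<Rightarrow> real" where
  "angle_measure (Segment p q) = 0"
| "angle_measure (Arc c r s t) = \<bar>t - s\<bar>"

definition rel_interior_side :: "side \<Rightarrow> complex set" where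
  "rel_interior_side S =
     path_image (side_path S) - {pathstart (side_path S), pathfinish (side_path S)}"

primrec inward :: "complex set \<Rightarrow> side \<Rightarrow> bool" where
  "inward R (Segment p q) \<longleftrightarrow> False"
| "inward R (Arc c r s t) \<longleftrightarrow>
     (\<exists>U. open U \<and> rel_interior_side (Arc c r s t) \<subseteq> U \<and> R \<inter> U \<subseteq> - cball c r)"

primrec outward :: "complex set \<Rightarrow> side \<Rightarrow> bool" where
  "outward R (Segment p q) \<longleftrightarrow> True"
| "outward R (Arc c r s t) \<longleftrightarrow>
     (\<exists>U. open U \<and> rel_interior_side (Arc c r s t) \<subseteq> U \<and> R \<inter> U \<subseteq> ball c r)"

fun join_paths :: "(real \<Rightarrow> complex) list \<Rightarrow> real \<Rightarrow> complex" where
  "join_paths [] = linepath 0 0"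
| "join_paths [g] = g"
| "join_paths (g # h # gs) = g +++ join_paths (h # gs)"

definition boundary_curve :: "nat \<Rightarrow> (nat \<Rightarrow> side) \<Rightarrow> real \<Rightarrow> complex" where
  "boundary_curve n S = join_paths (map (\<lambda>k. side_path (S k)) [1..<n + 1])"

definition polygon_region :: "nat \<Rightarrow> (nat \<Rightarrow> side) \<Rightarrow> complex set" where
  "polygon_region n S = inside (path_image (boundary_curve n S))"

definition positively_oriented :: "(real \<Rightarrow> complex) \<Rightarrow> bool" where
  "positively_oriented \<gamma> \<longleftrightarrow> (\<forall>w \<in> inside (path_image \<gamma>). winding_number \<gamma> w = 1)"

text \<open>The polygon with vertices \<open>z 1, \<dots>, z n\<close>; its \<open>k\<close>-th side \<open>S k\<close> goes from \<open>z k\<close> to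
  \<open>z (k + 1)\<close>. A \<open>simple_path\<close> whose end points agree is a Jordan curve.\<close>

definition hyperbolic_polygon :: "nat \<Rightarrow> (nat \<Rightarrow> complex) \<Rightarrow> (nat \<Rightarrow> side) \<Rightarrow> bool" where
  "hyperbolic_polygon n z S \<longleftrightarrow>
     z (n + 1) = z 1 \<and>
     (\<forall>k \<in> {1..n}. z k \<in> cball 0 1 \<and> z k \<noteq> z (k + 1) \<and> is_geodesic (S k) (z k) (z (k + 1))) \<and>
     simple_path (boundary_curve n S) \<and>
     pathfinish (boundary_curve n S) = pathstart (boundary_curve n S)"

end

(* The area form has the primitive 2 (x dy - y dx) / (1 - |z|^2), which is identically -du on an
   arc c + r e^{iu} orthogonal to the unit circle (there |c|^2 = 1 + r^2) and 0 on a diameter. So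
   the area is the sum of the signed angles swept clockwise by the arcs, even at ideal vertices.
   In place of Green's theorem, the indicator of the polygon is written as the winding number of
   its boundary; Fubini then turns the integral of the density over |w| < R into a contour integral
   of the Cauchy transform of a radial density, which by Newton's theorem is (mass of the disc
   |w| < |z|) / z; finally R tends to 1. A side is inward exactly when it is traversed clockwise:
   near an interior point of a side, subtracting the winding number of the full circle from that
   of the boundary leaves a continuous, hence locally constant, integer. *)

theory Submission
  imports Defs
begin

section \<open>Lebesgue measure in the plane: isometries and radial functions\<close>

text \<open>Each side is an open path, so its own winding number is in general neither an integer
  nor real; only the sum over all sides is 0 or 1. The exchange of integrals is therefore done for
  one side at a time, and reality is used only for the total. The truncation at \<open>R\<close> is
  forced by Fubini: the density has infinite mass on the unit disc, whereas the truncated density is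
  bounded, and \<open>1 / cmod w\<close> is locally integrable in the plane. This gives absolute
  convergence with a bound uniform in z up to and including the unit circle, so ideal vertices need
  no separate treatment. The disc |w| < m has mass 4 pi m^2 / (1 - m^2). Multiplied by Re (dz / (2
  pi i z)) = (x dy - y dx) / (2 pi |z|^2) at m = |z|, it reproduces exactly the primitive. The
  arctangent is a half-angle: if p and q sit at polar angles m - h and m + h of their orthogonal
  circle, the quotient in (ii) equals -tan h, and |h| < pi/2 because a geodesic arc is shorter than
  a half circle.\<close>

lemma ball_in_borel [measurable]: "ball (c::'a::metric_space) r \<in> sets borel"
  by simp

lemma nn_integral_lborel_shift:
  fixes f :: "'a::euclidean_space \<Rightarrow> ennreal"
  assumes [measurable]: "f \<in> borel_measurable borel"
  shows "(\<integral>\<^sup>+x. f (a + x) \<partial>lborel) = (\<integral>\<^sup>+x. f x \<partial>lborel)"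
proof -
  have "(\<integral>\<^sup>+x. f x \<partial>lborel) = (\<integral>\<^sup>+x. f x \<partial>(distr lborel borel ((+) a)))"
    by (simp add: lborel_distr_plus)
  also have "\<dots> = (\<integral>\<^sup>+x. f (a + x) \<partial>lborel)"
    by (subst nn_integral_distr) auto
  finally show ?thesis by simp
qed

lemma nn_integral_lborel_isometry:
  fixes f :: "'a::euclidean_space \<Rightarrow> ennreal" and T :: "'a \<Rightarrow> 'a"
  assumes T: "orthogonal_transformation T" and [measurable]: "f \<in> borel_measurable borel"
  shows "(\<integral>\<^sup>+x. f (T x) \<partial>lborel) = (\<integral>\<^sup>+x. f x \<partial>lborel)"
proof -
  have lin: "linear T" and nT: "\<And>x. norm (T x) = norm x"
    using T by (auto simp: orthogonal_transformation)
  have bl: "bounded_linear T" using lin by (simp add: linear_conv_bounded_linear)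
  then have [measurable]: "T \<in> borel_measurable borel"
    by (intro borel_measurable_continuous_onI linear_continuous_on)
  have "surj T" using T by (rule orthogonal_transformation_surj)
  \<comment> \<open>Uniqueness of Haar measure in miniature: integrate \<open>f x * h (x - T y)\<close> in both orders,
    with \<open>h\<close> the indicator of the unit ball, which \<open>T\<close> preserves.\<close>
  define h :: "'a \<Rightarrow> ennreal" where "h = indicator (ball 0 1)"
  have [measurable]: "h \<in> borel_measurable borel" unfolding h_def by measurable
  have hT: "h (T x) = h x" for x by (simp add: h_def indicator_def nT)
  have hm: "h (- x) = h x" for x by (simp add: h_def indicator_def)
  define B where "B = (\<integral>\<^sup>+x. h x \<partial>(lborel :: 'a measure))"
  have Beq: "B = ennreal (unit_ball_vol (DIM('a)))"
    unfolding B_def h_def by (subst nn_integral_indicator) (auto simp: emeasure_ball)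
  have h_shift: "(\<integral>\<^sup>+y. h (x - T y) \<partial>lborel) = B" for x
  proof -
    obtain x' where x: "x = T x'" using \<open>surj T\<close> by blast
    have "h (x - T y) = h (- x' + y)" for y
      using hT[of "x' - y"] hm[of "x' - y"] lin by (simp add: x linear_diff)
    then show ?thesis unfolding B_def by (simp only: nn_integral_lborel_shift[where f=h] \<open>h \<in> _\<close>)
  qed
  have f_shift: "(\<integral>\<^sup>+y. f (x + T y) \<partial>lborel) = (\<integral>\<^sup>+y. f (T y) \<partial>lborel)" for x
  proof -
    obtain x' where x: "x = T x'" using \<open>surj T\<close> by blast
    have "f (x + T y) = f (T (x' + y))" for y using lin by (simp add: x linear_add)
    then show ?thesis using nn_integral_lborel_shift[where f="\<lambda>y. f (T y)" and a=x'] by simp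
  qed
  have "(\<integral>\<^sup>+x. f x \<partial>lborel) * B = (\<integral>\<^sup>+x. (\<integral>\<^sup>+y. f x * h (x - T y) \<partial>lborel) \<partial>lborel)"
    by (subst nn_integral_multc[symmetric], simp, intro nn_integral_cong, subst nn_integral_cmult)
       (auto simp: h_shift)
  also have "\<dots> = (\<integral>\<^sup>+y. (\<integral>\<^sup>+x. f x * h (x - T y) \<partial>lborel) \<partial>lborel)"
    by (rule lborel_pair.Fubini') measurable
  also have "\<dots> = (\<integral>\<^sup>+y. (\<integral>\<^sup>+x. f (x + T y) * h x \<partial>lborel) \<partial>lborel)"
  proof (rule nn_integral_cong)
    fix y
    show "(\<integral>\<^sup>+x. f x * h (x - T y) \<partial>lborel) = (\<integral>\<^sup>+x. f (x + T y) * h x \<partial>lborel)"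
      using nn_integral_lborel_shift[where f="\<lambda>x. f x * h (x - T y)" and a="T y"]
      by (simp add: add.commute)
  qed
  also have "\<dots> = (\<integral>\<^sup>+x. (\<integral>\<^sup>+y. f (x + T y) * h x \<partial>lborel) \<partial>lborel)"
    by (rule lborel_pair.Fubini') measurable
  also have "\<dots> = (\<integral>\<^sup>+x. (\<integral>\<^sup>+y. f (T y) \<partial>lborel) * h x \<partial>lborel)"
    by (intro nn_integral_cong) (subst nn_integral_multc, auto simp: f_shift)
  also have "\<dots> = (\<integral>\<^sup>+y. f (T y) \<partial>lborel) * B"
    unfolding B_def by (subst nn_integral_cmult) auto
  finally have "(\<integral>\<^sup>+x. f x \<partial>lborel) * B = (\<integral>\<^sup>+y. f (T y) \<partial>lborel) * B" .
  moreover have "0 < unit_ball_vol (real DIM('a))" by simp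
  then have "B \<noteq> 0" "B \<noteq> top" unfolding Beq by (auto simp del: unit_ball_vol_pos)
  ultimately show ?thesis
    by (metis mult_divide_eq_ennreal)
qed

lemma distr_lborel_isometry:
  fixes T :: "'a::euclidean_space \<Rightarrow> 'a"
  assumes T: "orthogonal_transformation T"
  shows "distr lborel borel T = lborel"
proof (rule measure_eqI)
  have lin: "linear T" using T by (auto simp: orthogonal_transformation)
  have bl: "bounded_linear T" using lin by (simp add: linear_conv_bounded_linear)
  then have [measurable]: "T \<in> borel_measurable borel"
    by (intro borel_measurable_continuous_onI linear_continuous_on)
  fix A assume "A \<in> sets (distr lborel borel T)"
  then have [measurable]: "A \<in> sets borel" by simp
  show "emeasure (distr lborel borel T) A = emeasure lborel A"
    using nn_integral_lborel_isometry[OF T, of "indicator A"]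
      nn_integral_distr[of T lborel borel "indicator A"]
    by simp
qed simp

lemma orthogonal_transformation_cmult:
  assumes "cmod a = 1"
  shows "orthogonal_transformation (\<lambda>w. a * w)"
  using assms by (auto simp: orthogonal_transformation norm_mult intro!: linearI simp: algebra_simps)

text \<open>The disc |w|^2 < x has area pi x, so |w|^2 pushes Lebesgue measure forward to pi du on
  the half-line. Using the square of the radius as variable makes this image measure
  uniform.\<close>

lemma nn_integral_radial:
  fixes f :: "real \<Rightarrow> ennreal"
  assumes [measurable]: "f \<in> borel_measurable borel"
  shows "(\<integral>\<^sup>+w. f ((cmod w)\<^sup>2) \<partial>lborel) = ennreal pi * (\<integral>\<^sup>+u. f u * indicator {0..} u \<partial>lborel)"
proof -
  \<comment> \<open>The sign makes the measures of the rays \<open>{x<..}\<close> finite.\<close>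
  have "distr lborel borel (\<lambda>w::complex. - (cmod w)\<^sup>2) =
      density lborel (\<lambda>u. ennreal pi * indicator {..0} u)"
  proof (rule measure_eqI_lessThan)
    fix x :: real
    have "emeasure (distr lborel borel (\<lambda>w::complex. - (cmod w)\<^sup>2)) {x<..} =
        emeasure lborel {w::complex. (cmod w)\<^sup>2 < - x}"
      by (subst emeasure_distr) (auto simp: vimage_def intro!: arg_cong[where f="emeasure lborel"])
    also have "\<dots> = ennreal (pi * max 0 (- x))"
    proof (cases "x < 0")
      case True
      then have "{w::complex. (cmod w)\<^sup>2 < - x} = ball 0 (sqrt (-x))"
        by (auto simp: real_less_rsqrt) (metis norm_ge_zero real_sqrt_less_iff real_sqrt_unique)
      then show ?thesis using True by (simp add: emeasure_ball unit_ball_vol_2 max_def)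
    next
      case False
      then have "{w::complex. (cmod w)\<^sup>2 < - x} = {}"
        by (auto simp: not_less) (smt (verit) zero_le_power2)
      then show ?thesis using False by (simp add: max_def)
    qed
    finally have L: "emeasure (distr lborel borel (\<lambda>w::complex. - (cmod w)\<^sup>2)) {x<..}
        = ennreal (pi * max 0 (- x))" .
    have "emeasure (density lborel (\<lambda>u. ennreal pi * indicator {..0} u)) {x<..}
      = (\<integral>\<^sup>+u. ennreal pi * indicator ({..0} \<inter> {x<..}) u \<partial>lborel)"
      by (subst emeasure_density) (auto intro!: nn_integral_cong simp: indicator_def)
    also have "{..0} \<inter> {x<..} = {x<..0}" by auto
    also have "(\<integral>\<^sup>+u. ennreal pi * indicator {x<..0} u \<partial>lborel) = ennreal (pi * max 0 (- x))"
      by (subst nn_integral_cmult) (auto simp: max_def ennreal_mult)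
    finally show "emeasure (distr lborel borel (\<lambda>w::complex. - (cmod w)\<^sup>2)) {x<..} =
        emeasure (density lborel (\<lambda>u. ennreal pi * indicator {..0} u)) {x<..}"
      using L by simp
    show "emeasure (distr lborel borel (\<lambda>w::complex. - (cmod w)\<^sup>2)) {x<..} < \<infinity>"
      using L by simp
  qed auto
  then have "(\<integral>\<^sup>+u. f (- u) \<partial>distr lborel borel (\<lambda>w::complex. - (cmod w)\<^sup>2)) =
     (\<integral>\<^sup>+u. f (- u) \<partial>density lborel (\<lambda>u. ennreal pi * indicator {..0} u))" by simp
  then have "(\<integral>\<^sup>+w. f ((cmod w)\<^sup>2) \<partial>lborel) =
      (\<integral>\<^sup>+u. ennreal pi * indicator {..0} u * f (- u) \<partial>lborel)"
    by (subst (asm) nn_integral_distr, simp, simp, subst (asm) nn_integral_density) auto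
  also have "\<dots> = (\<integral>\<^sup>+u. ennreal pi * indicator {..0} u * f (- u) \<partial>distr lborel borel uminus)"
    by (simp add: lborel_distr_uminus)
  also have "\<dots> = (\<integral>\<^sup>+u. ennreal pi * indicator {..0} (- u) * f u \<partial>lborel)"
    by (subst nn_integral_distr) auto
  also have "\<dots> = (\<integral>\<^sup>+u. ennreal pi * (f u * indicator {0..} u) \<partial>lborel)"
    by (intro nn_integral_cong) (auto simp: indicator_def)
  also have "\<dots> = ennreal pi * (\<integral>\<^sup>+u. f u * indicator {0..} u \<partial>lborel)"
    by (rule nn_integral_cmult) measurable
  finally show ?thesis .
qed

text \<open>Local integrability of the planar Cauchy kernel: in u = |w|^2 it becomes 1 / sqrt u,
  with antiderivative 2 sqrt u. The radius 2 bounds |z - w| for z in the closed and w in the open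
  unit disc.\<close>

lemma nn_integral_inverse_norm_finite:
  "(\<integral>\<^sup>+w. ennreal (1 / cmod w) * indicator (ball 0 2) w \<partial>lborel) < \<infinity>"
proof -
  have "(\<integral>\<^sup>+w. ennreal (1 / cmod w) * indicator (ball 0 2) w \<partial>lborel) =
    (\<integral>\<^sup>+w. ennreal (1 / sqrt ((cmod w)\<^sup>2)) * indicator {..<4} ((cmod w)\<^sup>2) \<partial>lborel)"
  proof (intro nn_integral_cong arg_cong2[where f="(*)"])
    fix w :: complex
    have "cmod w < 2 \<longleftrightarrow> (cmod w)\<^sup>2 < 4"
      using power2_less_imp_less[of "cmod w" 2] power_strict_mono[of "cmod w" 2 2] by auto
    then show "indicator (ball 0 2) w = (indicator {..<4} ((cmod w)\<^sup>2) :: ennreal)"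
      by (simp add: indicator_def)
  qed simp
  also have "\<dots> = ennreal pi * (\<integral>\<^sup>+u. ennreal (1 / sqrt u) * indicator {..<4} u * indicator {0..} u \<partial>lborel)"
    by (rule nn_integral_radial) measurable
  finally have radial: "(\<integral>\<^sup>+w. ennreal (1 / cmod w) * indicator (ball 0 2) w \<partial>lborel) =
    ennreal pi * (\<integral>\<^sup>+u. ennreal (1 / sqrt u) * indicator {..<4} u * indicator {0..} u \<partial>lborel)" .
  have "(\<integral>\<^sup>+u. ennreal (1 / sqrt u) * indicator {..<4} u * indicator {0..} u \<partial>lborel) =
      (\<integral>\<^sup>+u. ennreal (indicator (einterval (ereal 0) (ereal 4)) u *\<^sub>R (1 / sqrt u)) \<partial>lborel)"
  proof (intro nn_integral_cong)
    fix u :: real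
    have "u \<in> einterval (ereal 0) (ereal 4) \<longleftrightarrow> 0 < u \<and> u < 4" by (simp add: einterval_def)
    then show "ennreal (1 / sqrt u) * indicator {..<4} u * indicator {0..} u =
        ennreal (indicator (einterval (ereal 0) (ereal 4)) u *\<^sub>R (1 / sqrt u))"
      \<comment> \<open>At \<open>u = 0\<close> the convention for division gives
        \<open>1 / sqrt 0 = 0\<close>, so the open interval loses nothing.\<close>
      by (cases "u = 0") (auto simp: indicator_def)
  qed
  also have "\<dots> < \<infinity>"
  proof -
    have "set_integrable lborel (einterval (ereal 0) (ereal 4)) (\<lambda>u. 1 / sqrt u)"
    proof (rule interval_integral_FTC_nonneg(1)[where F="\<lambda>u. 2 * sqrt u" and A=0 and B=4])
      show "((\<lambda>u. 2 * sqrt u) has_real_derivative 1 / sqrt x) (at x)" if "ereal 0 < ereal x" for x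
        using that by (auto intro!: derivative_eq_intros simp: field_simps)
      show "isCont (\<lambda>u. 1 / sqrt u) x" if "ereal 0 < ereal x" for x
        using that by (auto intro!: continuous_intros)
      show "AE x in lborel. ereal 0 < ereal x \<longrightarrow> ereal x < ereal 4 \<longrightarrow> 0 \<le> 1 / sqrt x" by auto
      have "((\<lambda>u. 2 * sqrt u) \<longlongrightarrow> 2 * sqrt x) (at x within X)" for x X
        by (intro tendsto_intros)
      from this[of 0] this[of 4]
      show "(((\<lambda>u. 2 * sqrt u) \<circ> real_of_ereal) \<longlongrightarrow> 0) (at_right (ereal 0))"
           "(((\<lambda>u. 2 * sqrt u) \<circ> real_of_ereal) \<longlongrightarrow> 4) (at_left (ereal 4))"
        by (simp_all add: ereal_tendsto_simps)
    qed simp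
    then have "(\<integral>\<^sup>+u. ennreal (norm (indicator (einterval (ereal 0) (ereal 4)) u *\<^sub>R (1 / sqrt u))) \<partial>lborel) < \<infinity>"
      unfolding set_integrable_def by (simp only: integrable_iff_bounded)
    also have "(\<integral>\<^sup>+u. ennreal (norm (indicator (einterval (ereal 0) (ereal 4)) u *\<^sub>R (1 / sqrt u))) \<partial>lborel)
      = (\<integral>\<^sup>+u. ennreal (indicator (einterval (ereal 0) (ereal 4)) u *\<^sub>R (1 / sqrt u)) \<partial>lborel)"
      by (intro nn_integral_cong) (auto simp: indicator_def einterval_def)
    finally show ?thesis .
  qed
  finally have "(\<integral>\<^sup>+u. ennreal (1 / sqrt u) * indicator {..<4} u * indicator {0..} u \<partial>lborel) < \<infinity>" .
  with radial show ?thesis by (simp add: ennreal_mult_less_top)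
qed

section \<open>Hyperbolic area of discs about the origin\<close>

lemma hyperbolic_density_eq: "hyperbolic_density z = 4 / (1 - (cmod z)\<^sup>2)\<^sup>2"
  by (simp add: hyperbolic_density_def cmod_power2 power_divide algebra_simps)

text \<open>In u = |w|^2 the density is 4 / (1 - u)^2, with antiderivative 4 / (1 - u) on
  [0, m^2].\<close>

lemma nn_integral_hyperbolic_density_ball:
  assumes "0 \<le> m" "m < 1"
  shows "(\<integral>\<^sup>+w. ennreal (hyperbolic_density w) * indicator (ball 0 m) w \<partial>lborel) =
    ennreal (4 * pi * m\<^sup>2 / (1 - m\<^sup>2))"
proof -
  have m2: "m\<^sup>2 < 1" using assms by (simp add: power_less_one_iff abs_square_less_1)
  have "(\<integral>\<^sup>+w. ennreal (hyperbolic_density w) * indicator (ball 0 m) w \<partial>lborel) =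
    (\<integral>\<^sup>+w. ennreal (4 / (1 - (cmod w)\<^sup>2)\<^sup>2) * indicator {..<m\<^sup>2} ((cmod w)\<^sup>2) \<partial>lborel)"
  proof (intro nn_integral_cong arg_cong2[where f="(*)"])
    fix w :: complex
    have "cmod w < m \<longleftrightarrow> (cmod w)\<^sup>2 < m\<^sup>2"
      using assms power2_less_imp_less[of "cmod w" m] power_strict_mono[of "cmod w" m 2] by auto
    then show "indicator (ball 0 m) w = (indicator {..<m\<^sup>2} ((cmod w)\<^sup>2) :: ennreal)"
      by (simp add: indicator_def)
  qed (simp add: hyperbolic_density_eq)
  also have "\<dots> = ennreal pi * (\<integral>\<^sup>+u. ennreal (4 / (1 - u)\<^sup>2) * indicator {..<m\<^sup>2} u * indicator {0..} u \<partial>lborel)"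
    by (rule nn_integral_radial) measurable
  also have "(\<integral>\<^sup>+u. ennreal (4 / (1 - u)\<^sup>2) * indicator {..<m\<^sup>2} u * indicator {0..} u \<partial>lborel) = 
     (\<integral>\<^sup>+u. ennreal (4 / (1 - u)\<^sup>2) * indicator {0..m\<^sup>2} u \<partial>lborel)"
    by (intro nn_integral_cong_AE AE_I[where N="{m\<^sup>2}"]) (auto simp: indicator_def)
  also have "\<dots> = ennreal (4 / (1 - m\<^sup>2) - 4 / (1 - 0))"
  proof (rule nn_integral_FTC_Icc)
    show "((\<lambda>u. 4 / (1 - u)) has_real_derivative 4 / (1 - x)\<^sup>2) (at x)" if "x \<in> {0..m\<^sup>2}" for x
      using that m2 by (auto intro!: derivative_eq_intros simp: power2_eq_square)
  qed auto
  also have "ennreal pi * ennreal (4 / (1 - m\<^sup>2) - 4 / (1 - 0)) = ennreal (pi * (4 / (1 - m\<^sup>2) - 4 / (1 - 0)))"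
    by (simp add: ennreal_mult')
  also have "pi * (4 / (1 - m\<^sup>2) - 4 / (1 - 0)) = 4 * pi * m\<^sup>2 / (1 - m\<^sup>2)"
    using m2 by (simp add: field_simps)
  finally show ?thesis .
qed

section \<open>The Cauchy transform of the truncated density\<close>

text \<open>Supplies the hypothesis of both Fubini exchanges: the parameter interval has finite
  length, so an L1 bound in \<open>w\<close> that is uniform in \<open>t\<close> suffices.\<close>

lemma integrable_lborel_pair:
  fixes f :: "real \<Rightarrow> complex \<Rightarrow> complex" and C :: real
  assumes [measurable]: "case_prod f \<in> borel_measurable (lborel \<Otimes>\<^sub>M lborel)"
    and C: "\<And>t. (\<integral>\<^sup>+w. ennreal (cmod (f t w)) \<partial>lborel) \<le> ennreal C * indicator {0..1} t"
  shows "integrable (lborel \<Otimes>\<^sub>M lborel) (case_prod f)"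
proof (rule integrableI_bounded)
  have "(\<integral>\<^sup>+x. ennreal (norm (case_prod f x)) \<partial>(lborel \<Otimes>\<^sub>M lborel)) =
      (\<integral>\<^sup>+t. (\<integral>\<^sup>+w. ennreal (norm (f t w)) \<partial>lborel) \<partial>lborel)"
    by (subst lborel.nn_integral_fst[symmetric]) auto
  also have "\<dots> \<le> (\<integral>\<^sup>+t. ennreal C * indicator {0..1} t \<partial>(lborel :: real measure))"
    by (intro nn_integral_mono) (use C in simp)
  also have "\<dots> < \<infinity>" by (subst nn_integral_cmult) auto
  finally show "(\<integral>\<^sup>+x. ennreal (norm (case_prod f x)) \<partial>(lborel \<Otimes>\<^sub>M lborel)) < \<infinity>" .
qed fact

text \<open>The full density is not integrable over the unit disc. For \<open>R < 1\<close> this one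
  is bounded and still radial, which the Cauchy kernel estimate and the averaging over rotations
  require.\<close>

definition truncated_density :: "real \<Rightarrow> complex \<Rightarrow> real" where
  "truncated_density R w = hyperbolic_density w * indicator (ball 0 R) w"

definition disc_mass :: "real \<Rightarrow> real" where
  "disc_mass m = 4 * pi * m\<^sup>2 / (1 - m\<^sup>2)"

lemma hyperbolic_density_nonneg [simp]: "0 \<le> hyperbolic_density w"
  by (simp add: hyperbolic_density_def)

lemma measurable_hyperbolic_density [measurable]: "hyperbolic_density \<in> borel_measurable borel"
  unfolding hyperbolic_density_eq[abs_def] by measurable

lemma measurable_truncated_density [measurable]: "truncated_density R \<in> borel_measurable borel"
  unfolding truncated_density_def[abs_def] by measurable

lemma truncated_density_nonneg [simp]: "0 \<le> truncated_density R w"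
  by (simp add: truncated_density_def)

lemma truncated_density_le:
  assumes "0 < R" "R < 1"
  shows "truncated_density R w \<le> 4 / (1 - R\<^sup>2)\<^sup>2 * indicator (ball 0 1) w"
proof (cases "cmod w < R")
  case True
  have "(cmod w)\<^sup>2 \<le> R\<^sup>2" "R\<^sup>2 < 1" using True assms
    by (simp_all add: power_mono power_less_one_iff abs_square_less_1)
  then have "4 / (1 - (cmod w)\<^sup>2)\<^sup>2 \<le> 4 / (1 - R\<^sup>2)\<^sup>2"
    by (intro divide_left_mono power_mono mult_pos_pos) auto
  with True assms show ?thesis by (simp add: truncated_density_def hyperbolic_density_eq)
qed (simp add: truncated_density_def)

lemma truncated_density_rotate:
  assumes "cmod a = 1" shows "truncated_density R (a * w) = truncated_density R w"
  by (simp add: truncated_density_def hyperbolic_density_eq norm_mult assms indicator_def)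

text \<open>The truncated density is at most a constant \<open>D\<close> on the unit disc, so the
  integral is at most \<open>D\<close> times that of the kernel over a disc of radius 2 about
  \<open>z\<close>. The bound does not depend on \<open>z\<close> and includes |z| = 1.\<close>

lemma cauchy_kernel_bound:
  assumes "0 < R" "R < 1"
  obtains C where "0 \<le> C"
    "\<And>z::complex. cmod z \<le> 1 \<Longrightarrow>
      (\<integral>\<^sup>+w. ennreal (cmod (truncated_density R w / (z - w :: complex))) \<partial>lborel) \<le> ennreal C"
proof -
  define K where "K = (\<integral>\<^sup>+w. ennreal (1 / cmod w) * indicator (ball 0 2) w \<partial>lborel)"
  define D where "D = 4 / (1 - R\<^sup>2)\<^sup>2"
  have "K < \<infinity>" unfolding K_def by (rule nn_integral_inverse_norm_finite)
  then obtain k where k: "0 \<le> k" "K = ennreal k" by (cases K) auto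
  have "0 \<le> D" by (simp add: D_def)
  have "(\<integral>\<^sup>+w. ennreal (cmod (truncated_density R w / (z - w :: complex))) \<partial>lborel) \<le> ennreal (D * k)"
    if "cmod z \<le> 1" for z :: complex
  proof -
    have "(\<integral>\<^sup>+w. ennreal (cmod (truncated_density R w / (z - w :: complex))) \<partial>lborel) \<le>
      (\<integral>\<^sup>+w. ennreal D * (ennreal (1 / cmod (z - w)) * indicator (ball 0 2) (z - w)) \<partial>lborel)"
    proof (rule nn_integral_mono)
      fix w :: complex
      show "ennreal (cmod (truncated_density R w / (z - w))) \<le>
        ennreal D * (ennreal (1 / cmod (z - w)) * indicator (ball 0 2) (z - w))"
      proof (cases "cmod w < 1")
        case True
        then have "cmod (z - w) < 2" using that norm_triangle_ineq4[of z w] by linarith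
        moreover have "truncated_density R w \<le> D"
          using truncated_density_le[OF assms, of w] True by (simp add: D_def)
        then have "cmod (truncated_density R w / (z - w)) \<le> D * (1 / cmod (z - w))"
          by (simp add: norm_divide divide_right_mono)
        ultimately show ?thesis using \<open>0 \<le> D\<close>
          by (simp add: ennreal_mult[symmetric] ennreal_leI)
      next
        case False
        then have "truncated_density R w = 0" using assms by (simp add: truncated_density_def)
        then show ?thesis by simp
      qed
    qed
    also have "\<dots> = ennreal D * (\<integral>\<^sup>+w. (ennreal (1 / cmod (z - w)) * indicator (ball 0 2) (z - w)) \<partial>lborel)"
      by (rule nn_integral_cmult) (measurable, simp, intro open_Collect_less continuous_intros)
    \<comment> \<open>Reflection w -> -w followed by translation by \<open>z\<close> moves the disc
      about \<open>z\<close> to the origin.\<close>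
    also have "(\<integral>\<^sup>+w. (ennreal (1 / cmod (z - w)) * indicator (ball 0 2) (z - w)) \<partial>lborel) =
       (\<integral>\<^sup>+w. (ennreal (1 / cmod (z + w)) * indicator (ball 0 2) (z + w)) \<partial>lborel)"
      using nn_integral_lborel_isometry[where T=uminus and
        f="\<lambda>w. ennreal (1 / cmod (z + w)) * indicator (ball 0 2) (z + w)"]
      by (simp add: orthogonal_transformation_neg orthogonal_transformation_id[unfolded id_def])
    also have "\<dots> = K" unfolding K_def
      using nn_integral_lborel_shift[where a=z and f="\<lambda>w. ennreal (1 / cmod w) * indicator (ball 0 2) w"]
      by simp
    finally show ?thesis using k \<open>0 \<le> D\<close> by (simp add: ennreal_mult)
  qed
  with that[of "D * k"] k \<open>0 \<le> D\<close> show ?thesis by simp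
qed

lemma cmod_exp_two_pi: "cmod (exp (2 * of_real pi * \<i> * of_real t)) = 1"
  using norm_exp_i_times[of "2 * pi * t"] by (simp add: mult_ac)

text \<open>With u = exp (2 pi i t) one has dt = du / (2 pi i u), and the partial fractions 1 / (u
  (z - u w)) = (1 / u - 1 / (u - z / w)) / z reduce the mean to two winding numbers of the unit
  circle: 1 about 0, and \<open>W\<close> about z / w, which is 1 exactly when |z| < |w|.\<close>

lemma set_integral_circle_average:
  fixes z w :: complex
  assumes "z \<noteq> 0" "w \<noteq> 0" "cmod w \<noteq> cmod z"
  shows "(LINT t:{0..1}|lborel. 1 / (z - exp (2 * of_real pi * \<i> * of_real t) * w)) =
    (if cmod w < cmod z then 1 / z else 0)"
proof -
  let ?c = "complex_of_real (2 * pi) * \<i>"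
  let ?e = "\<lambda>t::real. exp (2 * of_real pi * \<i> * of_real t)"
  define W where "W = winding_number (circlepath 0 1) (z / w)"
  have nrm: "cmod (z / w) \<noteq> 1" using assms by (simp add: norm_divide divide_simps)
  have W: "W = (if cmod w < cmod z then 0 else 1)"
  proof (cases "cmod w < cmod z")
    case True
    then have "z / w \<notin> cball 0 1" using assms by (simp add: norm_divide divide_simps)
    then have "W = 0" unfolding W_def
      by (intro winding_number_zero_outside[where s="cball 0 1"]) auto
    with True show ?thesis by simp
  next
    case False
    then have "cmod (z / w) < 1" using assms by (simp add: norm_divide divide_simps)
    then have "W = 1" unfolding W_def by (intro winding_number_circlepath) auto
    with False show ?thesis by simp
  qed
  have 0: "((\<lambda>u. 1 / (u - 0)) has_contour_integral (?c * winding_number (circlepath 0 1) 0)) (circlepath 0 1)"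
    by (rule has_contour_integral_winding_number) auto
  have 1: "((\<lambda>u. 1 / (u - z / w)) has_contour_integral (?c * W)) (circlepath 0 1)"
    unfolding W_def by (rule has_contour_integral_winding_number) (use nrm in auto)
  have "winding_number (circlepath 0 1) 0 = 1" by (intro winding_number_circlepath) auto
  note wn0 = this
  have val: "(?c * 1 - ?c * W) / (?c * z) = (1 - W) / z"
    using mult_divide_mult_cancel_left[of "?c" "1 - W" z] by (simp add: algebra_simps)
  from has_contour_integral_diff[OF 0 1, unfolded wn0]
  have "((\<lambda>u. (1 / (u - 0) - 1 / (u - z / w)) / (?c * z)) has_contour_integral
      ((?c * 1 - ?c * W) / (?c * z))) (circlepath 0 1)"
    by (rule has_contour_integral_div)
  then have "((\<lambda>u. (1 / (u - 0) - 1 / (u - z / w)) / (?c * z)) has_contour_integral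
      ((1 - W) / z)) (circlepath 0 1)"
    by (simp only: val)
  moreover have vd: "vector_derivative (circlepath 0 1) (at t) = ?c * ?e t"
      "circlepath 0 1 t = ?e t" for t
    by (simp add: vector_derivative_circlepath, simp add: circlepath)
  ultimately have I: "((\<lambda>t. (1 / ?e t - 1 / (?e t - z / w)) / (?c * z) *
      (?c * ?e t)) has_integral ((1 - W) / z)) {0..1}"
    by (simp only: has_contour_integral vd diff_zero)
  have ne: "?e t * w \<noteq> z" for t :: real
  proof
    assume "?e t * w = z"
    then have "cmod (?e t) * cmod w = cmod z" by (metis norm_mult)
    then show False using assms by (simp add: cmod_exp_two_pi)
  qed
  have alg: "(1 / e - 1 / (e - z / w)) / (?c * z) * (?c * e) = 1 / (z - e * w)"
    if "e \<noteq> 0" "e * w \<noteq> z" for e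
  proof -
    have "e - z / w = (e * w - z) / w" using assms by (simp add: field_simps)
    then have "1 / e - 1 / (e - z / w) = z / (e * (z - e * w))"
      using that assms by (simp add: divide_simps) (simp add: algebra_simps)
    then show ?thesis using that assms by (simp add: divide_simps)
  qed
  have "(1 / ?e t - 1 / (?e t - z / w)) / (?c * z) * (?c * ?e t) = 1 / (z - ?e t * w)" for t :: real
    by (rule alg[OF exp_not_eq_zero ne])
  with I have hi: "((\<lambda>t. 1 / (z - ?e t * w)) has_integral ((1 - W) / z)) {0..1}"
    by (simp only:)
  have ne': "z - ?e t * w \<noteq> 0" for t using ne[of t] by simp
  have "set_integrable lborel {0..1::real} (\<lambda>t. 1 / (z - ?e t * w))"
    by (intro borel_integrable_atLeastAtMost' continuous_intros ballI ne')
  then have "(LINT t:{0..1}|lborel. 1 / (z - ?e t * w)) = (1 - W) / z"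
    using integral_unique[OF hi] by (simp only: set_borel_integral_eq_integral)
  then show ?thesis using W by simp
qed

lemma AE_lborel_not_in_sphere: "AE w in lborel. cmod (w - c :: complex) \<noteq> r"
proof (rule AE_I')
  show "sphere c r \<in> null_sets lborel"
    using negligible_sphere[of c r]
    by (auto simp: null_sets_completion_iff negligible_iff_null_sets)
qed (auto simp: dist_norm norm_minus_commute)

lemma truncated_mass:
  assumes "0 \<le> \<rho>" "0 < R" "R < 1"
  shows "(LINT w|lborel. truncated_density R w * indicator (ball 0 \<rho>) w) = disc_mass (min \<rho> R)"
proof (rule integral_eq_nn_integral[THEN trans])
  have "(\<integral>\<^sup>+w. ennreal (truncated_density R w * indicator (ball 0 \<rho>) w) \<partial>lborel) =
      (\<integral>\<^sup>+w. ennreal (hyperbolic_density w) * indicator (ball 0 (min \<rho> R)) w \<partial>lborel)"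
    by (intro nn_integral_cong) (auto simp: truncated_density_def indicator_def)
  also have "\<dots> = ennreal (disc_mass (min \<rho> R))"
    unfolding disc_mass_def using assms by (intro nn_integral_hyperbolic_density_ball) auto
  finally have "(\<integral>\<^sup>+w. ennreal (truncated_density R w * indicator (ball 0 \<rho>) w) \<partial>lborel) =
      ennreal (disc_mass (min \<rho> R))" .
  moreover have "(min \<rho> R)\<^sup>2 < 1" using assms by (auto simp: power_less_one_iff abs_square_less_1 min_def)
  then have "0 \<le> disc_mass (min \<rho> R)" unfolding disc_mass_def by simp
  ultimately show "enn2real (\<integral>\<^sup>+w. ennreal (truncated_density R w * indicator (ball 0 \<rho>) w) \<partial>lborel) =
     disc_mass (min \<rho> R)" by simp
qed simp_all

text \<open>Newton's theorem in the plane: after averaging, the mass on |w| < |z| acts as if placed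
  at 0, and the mass on |w| > |z| has no effect. The minimum with \<open>R\<close> appears because
  all mass lies in |w| < R.\<close>

lemma cauchy_transform_truncated_density:
  fixes z :: complex
  assumes R: "0 < R" "R < 1" and z: "z \<noteq> 0" "cmod z \<le> 1"
  shows "(LINT w|lborel. truncated_density R w / (z - w :: complex)) = disc_mass (min (cmod z) R) / z"
proof -
  let ?e = "\<lambda>t::real. exp (2 * of_real pi * \<i> * of_real t)"
  define F :: complex where "F = (LINT w|lborel. truncated_density R w / (z - w))"
  have ne: "cmod (?e t) = 1" for t
    by (rule cmod_exp_two_pi)
  obtain C where C': "0 \<le> C" "\<And>z::complex. cmod z \<le> 1 \<Longrightarrow>
      (\<integral>\<^sup>+w. ennreal (cmod (truncated_density R w / (z - w))) \<partial>lborel) \<le> ennreal C"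
    using cauchy_kernel_bound[OF R] by blast
  note C = C'(1) C'(2)[OF z(2)]
  define f where "f t w = indicator {0..1} t *\<^sub>R (truncated_density R w / (z - ?e t * w))" for t w
  have [measurable]: "case_prod f \<in> borel_measurable (lborel \<Otimes>\<^sub>M lborel)"
    unfolding f_def by measurable
  have rot: "(\<lambda>w. ?e t * w) \<in> borel_measurable borel" for t by measurable
  have iso: "distr lborel borel (\<lambda>w. ?e t * w) = lborel" for t
    by (intro distr_lborel_isometry orthogonal_transformation_cmult ne)
  have kernel [measurable]: "(\<lambda>w. complex_of_real (truncated_density R w) / (z - w)) \<in> borel_measurable borel"
    by measurable
  \<comment> \<open>The density is radial, so \<open>w\<close> may be averaged over its circle before integrating.\<close>
  have rotF: "(LINT w|lborel. complex_of_real (truncated_density R w) / (z - ?e t * w)) = F" for t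
  proof -
    have "F = (LINT w|distr lborel borel (\<lambda>w. ?e t * w). complex_of_real (truncated_density R w) / (z - w))"
      by (simp add: iso F_def)
    also have "\<dots> = (LINT w|lborel. complex_of_real (truncated_density R (?e t * w)) / (z - ?e t * w))"
        by (rule integral_distr) (use rot kernel in simp_all)
    finally show ?thesis by (simp add: truncated_density_rotate ne)
  qed
  have int: "integrable (lborel \<Otimes>\<^sub>M lborel) (case_prod f)"
  proof (rule integrable_lborel_pair)
    fix t
    have "(\<integral>\<^sup>+w. ennreal (cmod (truncated_density R w / (z - ?e t * w))) \<partial>lborel) =
      (\<integral>\<^sup>+w. ennreal (cmod (truncated_density R (?e t * w) / (z - ?e t * w))) \<partial>lborel)"
      by (simp add: truncated_density_rotate ne)
    also have "\<dots> = (\<integral>\<^sup>+w. ennreal (cmod (truncated_density R w / (z - w :: complex))) \<partial>lborel)"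
      by (rule nn_integral_lborel_isometry[OF orthogonal_transformation_cmult[OF ne], where f="\<lambda>w. ennreal (cmod (complex_of_real (truncated_density R w) / (z - w)))"]) measurable
    finally have "(\<integral>\<^sup>+w. ennreal (cmod (truncated_density R w / (z - ?e t * w))) \<partial>lborel) \<le> ennreal C"
      using C by simp
    then show "(\<integral>\<^sup>+w. ennreal (cmod (f t w)) \<partial>lborel) \<le> ennreal C * indicator {0..1} t"
      by (cases "t \<in> {0..1}") (simp_all add: f_def)
  qed measurable
  have "F = (LINT t|lborel. (LINT w|lborel. f t w))"
  proof -
    have "(LINT w|lborel. f t w) = indicator {0..1} t *\<^sub>R F" for t
      using rotF[of t] by (simp only: f_def integral_scaleR_right)
    then show ?thesis by simp
  qed
  also have "\<dots> = (LINT w|lborel. (LINT t|lborel. f t w))"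
    using lborel_pair.Fubini_integral[OF int] by simp
  also have "\<dots> = (LINT w|lborel. complex_of_real (truncated_density R w * indicator (ball 0 (cmod z)) w) / z)"
  proof (rule integral_cong_AE)
    show "AE w in lborel. (LINT t|lborel. f t w) =
        complex_of_real (truncated_density R w * indicator (ball 0 (cmod z)) w) / z"
      \<comment> \<open>On |w| = |z| the kernel is singular on the circle of averaging, and at w = 0
        the quotient z / w is meaningless; both exceptional sets are null.\<close>
      using AE_lborel_not_in_sphere[of 0 "cmod z"] AE_lborel_not_in_sphere[of 0 0]
    proof eventually_elim
      case (elim w)
      have "f t w = truncated_density R w * (indicator {0..1} t *\<^sub>R (1 / (z - ?e t * w)))" for t
        by (simp add: f_def)
      then have eq: "(LINT t|lborel. f t w) = truncated_density R w * (LINT t:{0..1}|lborel. 1 / (z - ?e t * w))"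
        by (simp only: set_lebesgue_integral_def integral_mult_right_zero)
      have "(LINT t:{0..1}|lborel. 1 / (z - ?e t * w)) = (if cmod w < cmod z then 1 / z else 0)"
        by (rule set_integral_circle_average) (use elim z in auto)
      with eq show ?case by (cases "cmod w < cmod z") simp_all
    qed
    show "(\<lambda>w. LINT t|lborel. f t w) \<in> borel_measurable lborel"
    proof (rule lborel.borel_measurable_lebesgue_integral)
      show "case_prod (\<lambda>w t. f t w) \<in> borel_measurable (lborel \<Otimes>\<^sub>M lborel)"
        unfolding f_def by measurable
    qed
    show "(\<lambda>w. complex_of_real (truncated_density R w * indicator (ball 0 (cmod z)) w) / z) \<in> borel_measurable lborel"
      by measurable
  qed
  also have "\<dots> = complex_of_real (LINT w|lborel. truncated_density R w * indicator (ball 0 (cmod z)) w) / z"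
    by (simp only: integral_divide_zero integral_complex_of_real)
  also have "\<dots> = disc_mass (min (cmod z) R) / z"
    by (subst truncated_mass) (use R in auto)
  finally show ?thesis unfolding F_def .
qed

section \<open>Integrals of winding numbers\<close>

text \<open>Applied to one side at a time, hence to open paths: Fubini brings the
  \<open>w\<close>-integral inside, where the Cauchy transform evaluates it at the point \<gamma> t.
  Zeros of \<gamma> are tolerated on a null set because a diameter may pass through 0. The third
  conclusion later permits real parts to be taken under the integral.\<close>

lemma cauchy_transform_of_path:
  fixes \<gamma> \<gamma>' :: "real \<Rightarrow> complex"
  assumes R: "0 < R" "R < 1"
    and cont: "continuous_on UNIV \<gamma>" "continuous_on UNIV \<gamma>'"
    and disc: "\<And>t. t \<in> {0..1} \<Longrightarrow> cmod (\<gamma> t) \<le> 1"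
    and nz: "AE t in lborel. t \<in> {0..1} \<longrightarrow> \<gamma> t \<noteq> 0"
  shows "integrable lborel (\<lambda>w. truncated_density R w * (LINT t:{0..1}|lborel. \<gamma>' t / (\<gamma> t - w)))" (is ?I)
    and "(LINT w|lborel. truncated_density R w * (LINT t:{0..1}|lborel. \<gamma>' t / (\<gamma> t - w))) =
      (LINT t:{0..1}|lborel. \<gamma>' t * (disc_mass (min (cmod (\<gamma> t)) R) / \<gamma> t))" (is ?E)
    and "set_integrable lborel {0..1} (\<lambda>t. \<gamma>' t * (disc_mass (min (cmod (\<gamma> t)) R) / \<gamma> t))" (is ?T)
proof -
  obtain C where C: "0 \<le> C" "\<And>z::complex. cmod z \<le> 1 \<Longrightarrow>
      (\<integral>\<^sup>+w. ennreal (cmod (truncated_density R w / (z - w))) \<partial>lborel) \<le> ennreal C"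
    using cauchy_kernel_bound[OF R] by blast
  have [measurable]: "\<gamma> \<in> borel_measurable borel" "\<gamma>' \<in> borel_measurable borel"
    using cont by (auto intro: borel_measurable_continuous_onI)
  have "compact (\<gamma>' ` {0..1})"
    by (intro compact_continuous_image continuous_on_subset[OF cont(2)]) auto
  from compact_imp_bounded[OF this] obtain B where B: "\<And>t. t \<in> {0..1} \<Longrightarrow> cmod (\<gamma>' t) \<le> B"
    unfolding bounded_iff by blast
  have "0 \<le> B" using order_trans[OF norm_ge_zero B[of 0]] by simp
  define f where "f t w = indicator {0..1} t *\<^sub>R (truncated_density R w * (\<gamma>' t / (\<gamma> t - w)))" for t w
  have [measurable]: "case_prod f \<in> borel_measurable (lborel \<Otimes>\<^sub>M lborel)"
    unfolding f_def by measurable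
  have kernel [measurable]: "(\<lambda>w. complex_of_real (truncated_density R w) / (z - w)) \<in> borel_measurable borel" for z
    by measurable
  have f_eq: "f t w = indicator {0..1} t *\<^sub>R (\<gamma>' t * (truncated_density R w / (\<gamma> t - w)))" for t w
    by (simp add: f_def)
  have int: "integrable (lborel \<Otimes>\<^sub>M lborel) (case_prod f)"
  proof (rule integrable_lborel_pair)
    fix t
    show "(\<integral>\<^sup>+w. ennreal (cmod (f t w)) \<partial>lborel) \<le> ennreal (B * C) * indicator {0..1} t"
    proof (cases "t \<in> {0..1}")
      case True
      have "(\<integral>\<^sup>+w. ennreal (cmod (f t w)) \<partial>lborel) =
          (\<integral>\<^sup>+w. ennreal (cmod (\<gamma>' t)) * ennreal (cmod (truncated_density R w / (\<gamma> t - w))) \<partial>lborel)"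
      proof (intro nn_integral_cong)
        fix w
        have "f t w = \<gamma>' t * (truncated_density R w / (\<gamma> t - w))"
          using True by (simp add: f_def)
        then show "ennreal (cmod (f t w)) =
            ennreal (cmod (\<gamma>' t)) * ennreal (cmod (truncated_density R w / (\<gamma> t - w)))"
          by (simp only: norm_mult ennreal_mult norm_ge_zero)
      qed
      also have "\<dots> = ennreal (cmod (\<gamma>' t)) * (\<integral>\<^sup>+w. ennreal (cmod (truncated_density R w / (\<gamma> t - w))) \<partial>lborel)"
        by (rule nn_integral_cmult) measurable
      also have "\<dots> \<le> ennreal B * ennreal C"
        using True by (intro mult_mono C disc ennreal_leI B) auto
      finally show ?thesis using True \<open>0 \<le> B\<close> C by (simp add: ennreal_mult)
    qed (simp add: f_def)
  qed measurable
  have inner: "(LINT t|lborel. f t w) = truncated_density R w * (LINT t:{0..1}|lborel. \<gamma>' t / (\<gamma> t - w))" for w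
  proof -
    have "f t w = truncated_density R w * (indicator {0..1} t *\<^sub>R (\<gamma>' t / (\<gamma> t - w)))" for t
      by (simp add: f_def)
    then show ?thesis by (simp only: set_lebesgue_integral_def integral_mult_right_zero)
  qed
  show ?I using lborel_pair.integrable_snd[OF int] by (simp only: inner)
  have m1: "(\<lambda>t. LINT w|lborel. f t w) \<in> borel_measurable lborel"
    by (rule lborel.borel_measurable_lebesgue_integral) measurable
  have m2: "(\<lambda>t. indicator {0..1} t *\<^sub>R (\<gamma>' t * (disc_mass (min (cmod (\<gamma> t)) R) / \<gamma> t))) \<in> borel_measurable lborel"
    unfolding disc_mass_def by measurable
  have ae: "AE t in lborel. (LINT w|lborel. f t w) = 
    indicator {0..1} t *\<^sub>R (\<gamma>' t * (disc_mass (min (cmod (\<gamma> t)) R) / \<gamma> t))"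
    using nz
  proof eventually_elim
    case (elim t)
    have "(LINT w|lborel. f t w) =
        indicator {0..1} t *\<^sub>R (\<gamma>' t * (LINT w|lborel. truncated_density R w / (\<gamma> t - w)))"
      unfolding f_eq by (simp only: integral_scaleR_right integral_mult_right_zero)
    also have "\<dots> = indicator {0..1} t *\<^sub>R (\<gamma>' t * (disc_mass (min (cmod (\<gamma> t)) R) / \<gamma> t))"
    proof (cases "t \<in> {0..1}")
      case True
      then show ?thesis
        using cauchy_transform_truncated_density[OF R, of "\<gamma> t"] elim disc by simp
    qed simp
    finally show ?case .
  qed
  have "integrable lborel (\<lambda>t. LINT w|lborel. f t w)"
    by (rule lborel_pair.integrable_fst[OF int, simplified])
  then show ?T unfolding set_integrable_def
    by (rule integrable_cong_AE_imp[OF _ m2]) (use ae in \<open>simp add: eq_commute\<close>)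
  have "(LINT w|lborel. truncated_density R w * (LINT t:{0..1}|lborel. \<gamma>' t / (\<gamma> t - w))) =
      (LINT w|lborel. (LINT t|lborel. f t w))"
    by (simp only: inner)
  also have "\<dots> = (LINT t|lborel. (LINT w|lborel. f t w))"
    by (rule lborel_pair.Fubini_integral[OF int])
  also have "\<dots> = (LINT t:{0..1}|lborel. \<gamma>' t * (disc_mass (min (cmod (\<gamma> t)) R) / \<gamma> t))"
    unfolding set_lebesgue_integral_def by (rule integral_cong_AE[OF m1 m2 ae])
  finally show ?E .
qed

text \<open>Contour integrals are gauge integrals while Fubini is a Lebesgue statement; off the path
  the integrand is continuous on [0, 1], so the two integrals agree.\<close>

lemma winding_number_set_integral:
  assumes "valid_path \<gamma>" "w \<notin> path_image \<gamma>"
    and deriv: "\<And>t. (\<gamma> has_vector_derivative \<gamma>' t) (at t)"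
    and cont: "continuous_on UNIV \<gamma>'"
  shows "winding_number \<gamma> w = (LINT t:{0..1}|lborel. \<gamma>' t / (\<gamma> t - w)) / (2 * pi * \<i>)"
proof -
  have "((\<lambda>u. 1 / (u - w)) has_contour_integral (2 * pi * \<i> * winding_number \<gamma> w)) \<gamma>"
    using assms by (intro has_contour_integral_winding_number)
  moreover have "vector_derivative \<gamma> (at t) = \<gamma>' t" for t
    using deriv by (rule vector_derivative_at)
  ultimately have "((\<lambda>t. \<gamma>' t / (\<gamma> t - w)) has_integral (2 * pi * \<i> * winding_number \<gamma> w)) {0..1}"
    by (simp add: has_contour_integral)
  note int = integral_unique[OF this]
  have "continuous_on {0..1} \<gamma>" using assms by (simp add: valid_path_imp_path flip: path_def)
  moreover have "\<gamma> t - w \<noteq> 0" if "t \<in> {0..1}" for t using assms(2) that by (auto simp: path_image_def)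
  ultimately have "set_integrable lborel {0..1::real} (\<lambda>t. \<gamma>' t / (\<gamma> t - w))"
    by (intro borel_integrable_atLeastAtMost' continuous_intros continuous_on_subset[OF cont] ballI) auto
  then have "(LINT t:{0..1}|lborel. \<gamma>' t / (\<gamma> t - w)) = 2 * pi * \<i> * winding_number \<gamma> w"
    using int by (simp only: set_borel_integral_eq_integral)
  then show ?thesis by simp
qed

section \<open>Sides as smooth null curves\<close>

primrec side_velocity :: "side \<Rightarrow> real \<Rightarrow> complex" where
  "side_velocity (Segment p q) = (\<lambda>t. q - p)"
| "side_velocity (Arc c r s t) = (\<lambda>x. \<i> * r * (of_real t - of_real s) * exp (\<i> * linepath s t x))"

lemma valid_path_side [simp]: "valid_path (side_path S)"
  by (cases S) auto

lemma path_side [simp]: "path (side_path S)"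
  by (simp add: valid_path_imp_path)

lemma has_vector_derivative_side:
  "(side_path S has_vector_derivative side_velocity S x) (at x)"
  by (cases S) (auto intro!: has_vector_derivative_linepath_within has_vector_derivative_part_circlepath)

lemma continuous_on_side_path: "continuous_on UNIV (side_path S)"
  using has_vector_derivative_side
  by (meson continuous_at_imp_continuous_on has_vector_derivative_continuous)

lemma continuous_on_side_velocity: "continuous_on UNIV (side_velocity S)"
  by (cases S) (auto simp: linepath_def intro!: continuous_intros)

lemma negligible_closed_segment: "negligible (closed_segment a (b::complex))"
  using negligible_convex_frontier[OF convex_closed_segment, of a b]
  by (simp add: frontier_def interior_closed_segment_ge2)

lemma negligible_arc: "negligible (path_image (part_circlepath c r s t))"
proof (rule negligible_subset[OF negligible_sphere])
  show "path_image (part_circlepath c r s t) \<subseteq> sphere c \<bar>r\<bar>"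
    by (auto simp: path_image_def part_circlepath_def dist_norm norm_mult)
qed

lemma AE_not_on_side: "AE w in lborel. w \<notin> path_image (side_path S)"
proof (rule AE_I')
  have "negligible (path_image (side_path S))"
    by (cases S) (auto simp: negligible_closed_segment negligible_arc)
  moreover have "closed (path_image (side_path S))" by (simp add: closed_path_image)
  ultimately show "path_image (side_path S) \<in> null_sets lborel"
    by (auto simp: null_sets_completion_iff negligible_iff_null_sets)
qed auto

section \<open>Geodesics\<close>

lemma cmod_circle_point:
  "(cmod (c + of_real r * cis u))\<^sup>2 = (cmod c)\<^sup>2 + r\<^sup>2 + 2 * r * (Re c * cos u + Im c * sin u)"
proof -
  have "(r * cos u)\<^sup>2 + (r * sin u)\<^sup>2 = r\<^sup>2"
    by (simp add: power_mult_distrib flip: distrib_left)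
  then show ?thesis by (simp add: cmod_power2 power2_sum algebra_simps)
qed

text \<open>Pythagoras in the triangle 0, c, w for a common point w of the two circles, with the
  right angle at w.\<close>

lemma orthogonal_circle_norm:
  assumes "orthogonal_to_unit_circle c r"
  shows "0 < r" "(cmod c)\<^sup>2 = 1 + r\<^sup>2"
proof -
  show "0 < r" using assms by (simp add: orthogonal_to_unit_circle_def)
  obtain w where "w \<in> sphere c r \<inter> sphere 0 1"
    using assms unfolding orthogonal_to_unit_circle_def by blast
  moreover from this have "orthogonal (w - c) w"
    using assms unfolding orthogonal_to_unit_circle_def by blast
  ultimately have w: "dist c w = r" "cmod w = 1" "(w - c) \<bullet> w = 0"
    by (auto simp: orthogonal_def)
  have "r\<^sup>2 = (c - w) \<bullet> (c - w)" using w by (simp add: dist_norm power2_norm_eq_inner flip: w(1))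
  also have "\<dots> = c \<bullet> c - w \<bullet> w" using w(3) by (simp add: inner_diff inner_commute algebra_simps)
  finally show "(cmod c)\<^sup>2 = 1 + r\<^sup>2" using w(2) by (simp add: power2_norm_eq_inner[symmetric])
qed

text \<open>Since |c|^2 = 1 + r^2, the point at polar angle u has squared norm 1 + 2 r (r + k u)
  with a sinusoid \<open>k\<close>, so it lies in the closed disc iff k u <= -r. Because k (u + pi)
  = -k u, the arc cannot contain two opposite points and is shorter than a half circle.\<close>

lemma geodesic_arc:
  assumes geo: "is_geodesic (Arc c r s t) p q" and "p \<noteq> q"
  shows "0 < r" "(cmod c)\<^sup>2 = 1 + r\<^sup>2" "s \<noteq> t" "\<bar>t - s\<bar> < pi"
    "p = c + of_real r * cis s" "q = c + of_real r * cis t"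
    "\<And>u. u \<in> closed_segment s t \<Longrightarrow> cmod (c + of_real r * cis u) \<le> 1"
    "\<And>u. u \<in> open_segment s t \<Longrightarrow> cmod (c + of_real r * cis u) < 1"
proof -
  define k where "k u = Re c * cos u + Im c * sin u" for u
  show r: "0 < r" and c: "(cmod c)\<^sup>2 = 1 + r\<^sup>2"
    using geo by (auto intro: orthogonal_circle_norm)
  show p: "p = c + of_real r * cis s" and q: "q = c + of_real r * cis t"
    using geo by (auto simp: cis_conv_exp)
  show "s \<noteq> t" using p q \<open>p \<noteq> q\<close> by auto
  show closed: "cmod (c + of_real r * cis u) \<le> 1" if "u \<in> closed_segment s t" for u
    using geo that by (auto simp: path_image_part_circlepath' image_subset_iff)
  have norm_k: "(cmod (c + of_real r * cis u))\<^sup>2 = 1 + 2 * r * (r + k u)" for u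
    unfolding cmod_circle_point c k_def by (simp add: power2_eq_square algebra_simps)
  have k_le: "k u \<le> - r" if "u \<in> closed_segment s t" for u
  proof -
    have "2 * r * (r + k u) \<le> 0"
      using norm_k[of u] closed[OF that] power_le_one[of "cmod (c + of_real r * cis u)" 2] by simp
    then show ?thesis using r by (simp add: mult_le_0_iff)
  qed
  have kpi: "k (u + pi) = - k u" for u by (simp add: k_def)
  show lt_pi: "\<bar>t - s\<bar> < pi"
  proof (rule ccontr)
    assume "\<not> \<bar>t - s\<bar> < pi"
    then have "min s t \<in> closed_segment s t" "min s t + pi \<in> closed_segment s t"
      by (auto simp: closed_segment_eq_real_ivl min_def)
    from this[THEN k_le] kpi[of "min s t"] r show False by linarith
  qed
  show "cmod (c + of_real r * cis u) < 1" if u: "u \<in> open_segment s t" for u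
  proof (rule ccontr)
    assume "\<not> cmod (c + of_real r * cis u) < 1"
    moreover have uc: "u \<in> closed_segment s t" using u by (simp add: open_segment_def)
    ultimately have "cmod (c + of_real r * cis u) = 1" using closed[of u] by simp
    then have ku: "k u = - r" using norm_k[of u] r by simp
    define d where "d = min \<bar>u - s\<bar> \<bar>t - u\<bar>"
    \<comment> \<open>\<open>k\<close> is at most \<open>- r\<close> at \<open>u - d\<close> and \<open>u + d\<close>, but there it averages to \<open>- r * cos d\<close>.\<close>
    have "0 < d" "d < pi" "u - d \<in> closed_segment s t" "u + d \<in> closed_segment s t"
      using u lt_pi by (auto simp: d_def open_segment_eq_real_ivl closed_segment_eq_real_ivl split: if_splits)
    then have "k (u - d) + k (u + d) \<le> - 2 * r" "cos d < 1"
      using k_le[of "u - d"] k_le[of "u + d"] cos_monotone_0_pi[of 0 d] by auto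
    moreover have "k (u - d) + k (u + d) = 2 * k u * cos d"
      by (simp add: k_def cos_add cos_diff sin_add sin_diff algebra_simps)
    ultimately show False using ku r by (simp add: mult_less_cancel_left)
  qed
qed

text \<open>The signed angle swept clockwise, which is the contribution of the side to the area.\<close>

primrec side_turn :: "side \<Rightarrow> real" where
  "side_turn (Segment p q) = 0"
| "side_turn (Arc c r s t) = s - t"

text \<open>Twice this quantity is |p - q|^2 + (1 - |p|^2) + (1 - |q|^2). It is the denominator in
  the arctangent formula.\<close>

lemma one_minus_inner_pos:
  fixes p q :: complex
  assumes "cmod p \<le> 1" "cmod q \<le> 1" "p \<noteq> q"
  shows "0 < 1 - Re p * Re q - Im p * Im q"
proof -
  have "0 < (cmod (p - q))\<^sup>2" using assms by simp
  also have "(cmod (p - q))\<^sup>2 = (cmod p)\<^sup>2 + (cmod q)\<^sup>2 - 2 * (Re p * Re q + Im p * Im q)"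
    by (simp add: cmod_power2 power2_diff)
  finally show ?thesis
    using power_le_one[of "cmod p" 2] power_le_one[of "cmod q" 2] assms by simp
qed

text \<open>In terms of the middle angle \<open>m\<close> and the signed half-angle
  \<open>h\<close>, numerator and denominator share the factor 2 r (k + r cos h), and what remains
  is -tan h. The bound |h| < pi/2 places -h on the principal branch.\<close>

lemma arctan_geodesic:
  assumes geo: "is_geodesic S p q" and "p \<noteq> q" "cmod p \<le> 1" "cmod q \<le> 1"
  shows "2 * arctan ((Re p * Im q - Im p * Re q) / (1 - Re p * Re q - Im p * Im q)) = side_turn S"
proof (cases S)
  case (Segment a b)
  with geo have "collinear {0, p, q}" by simp
  then have "Re p * Im q - Im p * Re q = 0"
    by (auto simp: collinear_lemma)
  with Segment show ?thesis by simp
next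
  case (Arc c r s t)
  note arc = geodesic_arc[OF geo[unfolded Arc] \<open>p \<noteq> q\<close>]
  define h where "h = (t - s) / 2"
  define m where "m = (s + t) / 2"
  have st: "s = m - h" "t = m + h" by (auto simp: h_def m_def field_simps)
  define k where "k = Re c * cos m + Im c * sin m"
  have cc: "Re c * Re c + Im c * Im c = 1 + r * r"
    using arc(2) unfolding cmod_power2 by (simp add: power2_eq_square)
  have m1: "cos m * cos m + sin m * sin m = 1" and h1: "cos h * cos h + sin h * sin h = 1"
    by (simp_all flip: power2_eq_square)
  have N: "Re p * Im q - Im p * Re q = 2 * r * sin h * (k + r * cos h)"
  proof -
    have "Re p * Im q - Im p * Re q = 2 * r * sin h * k + 2 * (r * r) * (sin h * cos h) * (cos m * cos m + sin m * sin m)"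
      by (simp add: arc(5,6) st cos_add cos_diff sin_add sin_diff k_def algebra_simps del: sin_cos_squared_add3)
    then show ?thesis unfolding m1 by (simp add: algebra_simps)
  qed
  have D: "1 - Re p * Re q - Im p * Im q = - 2 * r * cos h * (k + r * cos h)"
  proof -
    have "1 - Re p * Re q - Im p * Im q = 1 - (Re c * Re c + Im c * Im c) - 2 * r * cos h * k
      - (r * r) * (cos h * cos h - sin h * sin h) * (cos m * cos m + sin m * sin m)"
      by (simp add: arc(5,6) st cos_add cos_diff sin_add sin_diff k_def algebra_simps del: sin_cos_squared_add3)
    \<comment> \<open>Orthogonality turns 1 - |c|^2 into -r^2 = -r^2 (cos^2 h + sin^2 h). Added to
      -r^2 cos 2h this is -2 r^2 cos^2 h, which brings out the factor \<open>k + r * cos h\<close>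
      of the numerator.\<close>
    also have "\<dots> = - r * r * (cos h * cos h + sin h * sin h) - 2 * r * cos h * k
      - (r * r) * (cos h * cos h - sin h * sin h)"
      by (simp only: cc m1 h1)
    finally show ?thesis by (simp add: algebra_simps del: sin_cos_squared_add3)
  qed
  \<comment> \<open>Positivity of the denominator is what makes the common factor
    cancellable.\<close>
  have "0 < - 2 * r * cos h * (k + r * cos h)"
    using one_minus_inner_pos[of p q] assms D by simp
  then have ne: "k + r * cos h \<noteq> 0" "cos h \<noteq> 0" "r \<noteq> 0" by auto
  have "(Re p * Im q - Im p * Re q) / (1 - Re p * Re q - Im p * Im q) = - tan h"
    unfolding N D using ne by (simp add: tan_def divide_simps)
  then have "arctan ((Re p * Im q - Im p * Re q) / (1 - Re p * Re q - Im p * Im q)) = - h"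
    using arctan_tan[of h] arc(4) by (simp add: arctan_minus h_def)
  then show ?thesis by (simp add: Arc h_def field_simps)
qed

section \<open>The contribution of one side to the truncated area\<close>

lemma AE_linepath_nonzero:
  fixes p q :: complex
  assumes "p \<noteq> q"
  shows "AE x in lborel. linepath p q x \<noteq> 0"
proof (rule AE_I')
  have uniq: "x = y" if "linepath p q x = 0" "linepath p q y = 0" for x y
  proof -
    have "(x - y) *\<^sub>R (q - p) = linepath p q x - linepath p q y"
      by (simp add: linepath_def algebra_simps)
    then show ?thesis using that assms by simp
  qed
  have "finite {x. linepath p q x = 0}"
  proof (cases "\<exists>y. linepath p q y = 0")
    case True
    then obtain y where "linepath p q y = 0" by blast
    with uniq have "{x. linepath p q x = 0} \<subseteq> {y}" by blast
    then show ?thesis by (rule finite_subset) simp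
  qed simp
  then show "{x. linepath p q x = 0} \<in> null_sets lborel"
    by (simp add: finite_imp_null_set_lborel)
qed auto

text \<open>Where |z| <= R the integrand is the primitive 2 (x dy - y dx) / (1 - |z|^2) pulled back
  to the side, because Im (dz / z) = (x dy - y dx) / |z|^2. Where |z| > R the mass is frozen at that
  of the disc of radius R.\<close>

definition truncated_side_integral :: "real \<Rightarrow> side \<Rightarrow> real" where
  "truncated_side_integral R S =
     (LINT x:{0..1}|lborel. Im (side_velocity S x / side_path S x) * disc_mass (min (cmod (side_path S x)) R) / (2 * pi))"

lemma geodesic_side_basics:
  assumes "is_geodesic S p q" "p \<noteq> q" "cmod p \<le> 1" "cmod q \<le> 1"
  shows "AE x in lborel. x \<in> {0..1} \<longrightarrow> side_path S x \<noteq> 0"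
    and "\<And>x. x \<in> {0..1} \<Longrightarrow> cmod (side_path S x) \<le> 1"
proof -
  have "(AE x in lborel. x \<in> {0..1} \<longrightarrow> side_path S x \<noteq> 0) \<and> (\<forall>x\<in>{0..1}. cmod (side_path S x) \<le> 1)"
  proof (cases S)
    case (Segment a b)
    have "path_image (linepath p q) \<subseteq> cball 0 1"
      using assms by (simp add: closed_segment_subset)
    then have "\<forall>x\<in>{0..1}. cmod (linepath p q x) \<le> 1"
      by (auto simp: path_image_def)
    with assms Segment AE_linepath_nonzero[of p q] show ?thesis by auto
  next
    case (Arc c r s t)
    note arc = geodesic_arc[OF assms(1)[unfolded Arc] \<open>p \<noteq> q\<close>]
    \<comment> \<open>An orthogonal circle misses the origin, since |c|^2 = 1 + r^2 > r^2.\<close>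
    have "c + of_real r * cis u \<noteq> 0" for u
    proof
      assume "c + of_real r * cis u = 0"
      then have "c = - (of_real r * cis u)" by (simp add: eq_neg_iff_add_eq_0)
      then have "cmod c = r" using arc(1) by (simp add: norm_mult)
      with arc(2) show False by simp
    qed
    moreover have "side_path S x = c + of_real r * cis (linepath s t x)" for x
      by (simp add: Arc part_circlepath_def cis_conv_exp)
    moreover have "linepath s t x \<in> closed_segment s t" if "x \<in> {0..1}" for x
      using that by (auto simp: linepath_image_01[symmetric])
    ultimately show ?thesis using arc(7) by auto
  qed
  then show "AE x in lborel. x \<in> {0..1} \<longrightarrow> side_path S x \<noteq> 0"
    and "\<And>x. x \<in> {0..1} \<Longrightarrow> cmod (side_path S x) \<le> 1" by auto
qed

text \<open>On an arc, Im (dz / z) is (s - t) (1 - \<rho>^2) / (2 \<rho>^2) dx, so at interior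
  parameters the integrand equals the constant s - t as soon as \<open>R\<close> exceeds \<rho>.
  Before that it is smaller in absolute value, hence a constant dominates, whether or not an end
  point is ideal.\<close>

lemma truncated_side_integral_tendsto:
  assumes geo: "is_geodesic S p q" and "p \<noteq> q" and R: "\<And>j. 0 < R j \<and> R j < 1" "R \<longlonglongrightarrow> 1"
  shows "(\<lambda>j. truncated_side_integral (R j) S) \<longlonglongrightarrow> side_turn S"
proof (cases S)
  case (Segment a b)
  with geo have S: "S = Segment p q" "collinear {0, p, q}" by auto
  \<comment> \<open>Along a diameter, velocity and position are real multiples of one common
    direction.\<close>
  have "Im ((q - p) / linepath p q x) = 0" for x
    using S(2) by (auto simp: collinear_lemma linepath_def Im_divide algebra_simps)
  then show ?thesis by (simp add: S truncated_side_integral_def set_lebesgue_integral_def)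
next
  case (Arc c r s t)
  note arc = geodesic_arc[OF geo[unfolded Arc] \<open>p \<noteq> q\<close>]
  define \<rho> where "\<rho> x = cmod (side_path S x)" for x
  define u where "u x = linepath s t x" for x
  have path: "side_path S x = c + of_real r * cis (u x)" for x
    by (simp add: Arc part_circlepath_def cis_conv_exp u_def)
  have vel: "side_velocity S x = \<i> * r * (t - s) * cis (u x)" for x
    by (simp add: Arc cis_conv_exp u_def)
  have \<rho>2: "(\<rho> x)\<^sup>2 = 1 + 2 * r * (r + (Re c * cos (u x) + Im c * sin (u x)))" for x
    unfolding \<rho>_def path cmod_circle_point arc(2) by (simp add: power2_eq_square algebra_simps)
  have \<rho>0: "0 < \<rho> x" for x
  proof -
    have "side_path S x \<noteq> 0"
    proof
      assume "side_path S x = 0"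
      then have "c = - (of_real r * cis (u x))" by (simp add: path eq_neg_iff_add_eq_0)
      then have "cmod c = r" using arc(1) by (simp add: norm_mult)
      with arc(2) show False by simp
    qed
    then show ?thesis by (simp add: \<rho>_def)
  qed
  have Im: "Im (side_velocity S x / side_path S x) = (s - t) * ((1 - (\<rho> x)\<^sup>2) / (\<rho> x)\<^sup>2) / 2" for x
  proof -
    have sc: "cos (u x) * cos (u x) + sin (u x) * sin (u x) = 1"
      by (simp flip: power2_eq_square)
    have "Im (side_velocity S x / side_path S x) = Im (side_velocity S x * cnj (side_path S x)) / (\<rho> x)\<^sup>2"
      by (simp add: complex_div_cnj[of "side_velocity S x"] \<rho>_def)
    also have "Im (side_velocity S x * cnj (side_path S x)) =
        r * (t - s) * (Re c * cos (u x) + Im c * sin (u x) + r * (cos (u x) * cos (u x) + sin (u x) * sin (u x)))"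
      by (simp add: vel path algebra_simps)
    \<comment> \<open>The formula for \<rho>^2 says that \<open>r\<close> times the bracket is
      (\<rho>^2 - 1) / 2; its sign turns t - s into s - t.\<close>
    also have "\<dots> = (s - t) * (1 - (\<rho> x)\<^sup>2) / 2"
      by (simp add: sc \<rho>2 algebra_simps)
    finally show ?thesis by simp
  qed
  define g where "g j x = (s - t) * ((1 - (\<rho> x)\<^sup>2) / (\<rho> x)\<^sup>2 * ((min (\<rho> x) (R j))\<^sup>2 / (1 - (min (\<rho> x) (R j))\<^sup>2)))" for j x
  have integrand: "Im (side_velocity S x / side_path S x) * disc_mass (min (cmod (side_path S x)) (R j)) / (2 * pi) = g j x" for j x
    by (simp add: Im disc_mass_def g_def flip: \<rho>_def)
  have in_open: "0 < \<rho> x \<and> \<rho> x < 1" if "x \<in> {0<..<1}" for x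
  proof -
    have "u x \<in> open_segment s t"
      using that arc(3) by (auto simp: u_def in_segment linepath_def)
    with arc(8) \<rho>0 show ?thesis by (simp add: \<rho>_def path)
  qed
  \<comment> \<open>At an ideal vertex \<rho> = 1 and \<open>g j x\<close> is 0 for every
    \<open>j\<close>, so the pointwise limit s - t fails there.\<close>
  have ends: "AE x in lborel. x \<noteq> 0 \<and> x \<noteq> (1::real)"
    by (rule AE_I[where N="{0,1}"]) (auto intro: finite_imp_null_set_lborel[THEN null_setsD1])
  have meas: "\<rho> \<in> borel_measurable borel"
    unfolding \<rho>_def by (intro borel_measurable_continuous_onI continuous_intros continuous_on_side_path)
  note [measurable] = meas
  have "(\<lambda>j. LINT x|lborel. indicator {0..1} x *\<^sub>R g j x) \<longlonglongrightarrow> (\<integral>x. indicator {0..1} x *\<^sub>R (s - t) \<partial>(lborel :: real measure))"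
  proof (rule integral_dominated_convergence[where s="\<lambda>j x. indicator {0..1} x *\<^sub>R g j x" and
        f="\<lambda>x::real. indicator {0..1} x *\<^sub>R (s - t)" and w="\<lambda>x::real. indicator {0..1} x *\<^sub>R \<bar>s - t\<bar>"])
    show "AE x in lborel. (\<lambda>j. indicator {0..1} x *\<^sub>R g j x) \<longlonglongrightarrow> indicator {0..1} x *\<^sub>R (s - t)"
      using ends
    proof eventually_elim
      case (elim x)
      show ?case
      proof (cases "x \<in> {0<..<1}")
        case True
        note \<rho>x = in_open[OF True]
        then have "\<forall>\<^sub>F j in sequentially. \<rho> x < R j"
          using R(2) by (intro order_tendstoD(1)) auto
        then have "\<forall>\<^sub>F j in sequentially. g j x = s - t"
        proof eventually_elim
          case (elim j)
          then have "min (\<rho> x) (R j) = \<rho> x" by simp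
          moreover have "(\<rho> x)\<^sup>2 < 1" using \<rho>x by (simp add: power_less_one_iff abs_square_less_1)
          ultimately show ?case using \<rho>x by (simp add: g_def)
        qed
        then show ?thesis by (intro tendsto_scaleR tendsto_const tendsto_eventually)
      qed (use elim in auto)
    qed
    show "AE x in lborel. norm (indicator {0..1} x *\<^sub>R g j x) \<le> indicator {0..1} x *\<^sub>R \<bar>s - t\<bar>" for j
      using ends
    proof eventually_elim
      case (elim x)
      show ?case
      proof (cases "x \<in> {0<..<1}")
        case True
        define a where "a = (\<rho> x)\<^sup>2"
        define b where "b = (min (\<rho> x) (R j))\<^sup>2"
        have ab: "0 < a" "a < 1" "0 \<le> b" "b \<le> a"
          using in_open[OF True] R(1)[of j]
          by (auto simp: a_def b_def abs_square_less_1 intro!: power_mono)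
        \<comment> \<open>The function v / (1 - v) is increasing on [0, 1) and b <= a.\<close>
        have "(1 - a) / a * (b / (1 - b)) \<le> 1"
          using ab by (simp add: divide_simps algebra_simps)
        moreover have "0 \<le> (1 - a) / a * (b / (1 - b))" using ab by simp
        ultimately have "\<bar>(1 - a) / a * (b / (1 - b))\<bar> \<le> 1" by linarith
        then have "\<bar>g j x\<bar> \<le> \<bar>s - t\<bar> * 1"
          unfolding g_def a_def[symmetric] b_def[symmetric] abs_mult[of "s - t"]
          by (rule mult_left_mono) simp
        with True show ?thesis by simp
      qed (use elim in auto)
    qed
  qed (auto simp: g_def)
  moreover have "(\<integral>x. indicator {0..1} x *\<^sub>R (s - t) \<partial>(lborel :: real measure)) = side_turn S"
    by (simp add: Arc)
  ultimately show ?thesis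
    by (simp only: truncated_side_integral_def set_lebesgue_integral_def integrand)
qed

section \<open>Jordan curves composed of several paths\<close>

lemma join_paths_path:
  assumes "gs \<noteq> []" "\<forall>g\<in>set gs. path g" "successively (\<lambda>g h. pathfinish g = pathstart h) gs"
  shows "path (join_paths gs) \<and> pathstart (join_paths gs) = pathstart (hd gs) \<and>
    path_image (join_paths gs) = (\<Union>g\<in>set gs. path_image g)"
  using assms by (induction gs rule: join_paths.induct) (auto simp: path_image_join)

lemma winding_number_join_paths:
  assumes "gs \<noteq> []" "\<forall>g\<in>set gs. path g" "successively (\<lambda>g h. pathfinish g = pathstart h) gs"
    "\<forall>g\<in>set gs. w \<notin> path_image g"
  shows "winding_number (join_paths gs) w = (\<Sum>g\<leftarrow>gs. winding_number g w)"
  using assms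
proof (induction gs rule: join_paths.induct)
  case (3 g h gs)
  then have "winding_number (g +++ join_paths (h # gs)) w =
      winding_number g w + winding_number (join_paths (h # gs)) w"
    using join_paths_path[of "h # gs"] by (intro winding_number_join) auto
  with 3 show ?case by simp
qed auto

text \<open>For a Jordan curve, hypothesis \<open>inj\<close> is loop-freeness; in this one-sided form it passes
  from \<open>g # gs\<close> to \<open>gs\<close>, although the remaining curve is no longer closed.\<close>

lemma join_paths_disjoint:
  assumes "gs \<noteq> []" "\<forall>g\<in>set gs. path g" "successively (\<lambda>g h. pathfinish g = pathstart h) gs"
    and inj: "\<And>x y. \<lbrakk>0 < x; x < 1; 0 \<le> y; y \<le> 1; join_paths gs x = join_paths gs y\<rbrakk> \<Longrightarrow> x = y"
    and "i < length gs" "0 < u" "u < (1::real)"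
  shows "(\<exists>x. 0 < x \<and> x < 1 \<and> join_paths gs x = (gs ! i) u) \<and>
    (\<forall>j<length gs. j \<noteq> i \<longrightarrow> (gs ! i) u \<notin> path_image (gs ! j))"
  using assms
proof (induction gs arbitrary: i rule: join_paths.induct)
  case (3 g h gs)
  define J where "J = join_paths (h # gs)"
  have J: "pathstart J = pathstart h" "path_image J = (\<Union>g\<in>set (h # gs). path_image g)"
    using join_paths_path[of "h # gs"] 3(2-4) by (auto simp: J_def)
  have J0: "J 0 = g 1" using J(1) 3(4) by (simp add: pathstart_def pathfinish_def)
  have left: "(g +++ J) (x / 2) = g x" if "x \<le> 1" for x
    using that by (simp add: joinpaths_def)
  \<comment> \<open>At \<open>x = 0\<close> the parameter is 1/2, where \<open>+++\<close> still
    follows \<open>g\<close>; the value agrees by \<open>J0\<close>.\<close>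
  have right: "(g +++ J) ((1 + x) / 2) = J x" if "0 \<le> x" for x
    using that J0 by (cases "x = 0") (auto simp: joinpaths_def field_simps)
  have inj: "x = y" if "0 < x" "x < 1" "0 \<le> y" "y \<le> 1" "(g +++ J) x = (g +++ J) y" for x y
    using 3(5)[of x y] that by (simp add: J_def)
  have J_inj: "x = y" if "0 < x" "x < 1" "0 \<le> y" "y \<le> 1" "J x = J y" for x y
  proof -
    have "(g +++ J) ((1 + x) / 2) = (g +++ J) ((1 + y) / 2)" using that by (simp only: right)
    then have "(1 + x) / 2 = (1 + y) / 2" by (rule inj[rotated -1]) (use that in auto)
    then show ?thesis by simp
  qed
  show ?case
  proof (cases i)
    case 0
    have "g u \<notin> path_image J"
    proof
      assume "g u \<in> path_image J"
      then obtain y where y: "0 \<le> y" "y \<le> 1" "g u = J y" by (auto simp: path_image_def)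
      then have "(g +++ J) (u / 2) = (g +++ J) ((1 + y) / 2)" using 3(8) by (simp only: left right)
      then have "u / 2 = (1 + y) / 2" by (rule inj[rotated -1]) (use y 3(7,8) in auto)
      with y 3(8) show False by simp
    qed
    have "\<forall>j<length (g # h # gs). j \<noteq> i \<longrightarrow> g u \<notin> path_image ((g # h # gs) ! j)"
    proof (intro allI impI)
      fix j assume "j < length (g # h # gs)" "j \<noteq> i"
      with 0 obtain j' where "j = Suc j'" "j' < length (h # gs)" by (cases j) auto
      then have "(g # h # gs) ! j \<in> set (h # gs)" by (metis nth_Cons_Suc nth_mem)
      with \<open>g u \<notin> path_image J\<close> J(2) show "g u \<notin> path_image ((g # h # gs) ! j)" by blast
    qed
    moreover have "0 < u / 2 \<and> u / 2 < 1 \<and> join_paths (g # h # gs) (u / 2) = g u"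
      using 3(7,8) left[of u] by (simp add: J_def)
    ultimately show ?thesis using 0 by (metis nth_Cons_0)
  next
    case (Suc i')
    have IH: "(\<exists>x. 0 < x \<and> x < 1 \<and> J x = ((h # gs) ! i') u) \<and>
      (\<forall>j<length (h # gs). j \<noteq> i' \<longrightarrow> ((h # gs) ! i') u \<notin> path_image ((h # gs) ! j))"
      unfolding J_def
      by (rule "3.IH") (use 3(2-8) Suc J_inj in \<open>auto simp: J_def\<close>)
    then obtain x where x: "0 < x" "x < 1" "J x = ((h # gs) ! i') u" by blast
    have "J x \<notin> path_image g"
    proof
      assume "J x \<in> path_image g"
      then obtain y where y: "0 \<le> y" "y \<le> 1" "J x = g y" by (auto simp: path_image_def)
      then have "(g +++ J) ((1 + x) / 2) = (g +++ J) (y / 2)" using x by (simp only: left right)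
      then have "(1 + x) / 2 = y / 2" by (rule inj[rotated -1]) (use x y in auto)
      with x y show False by simp
    qed
    then have "\<forall>j<length (g # h # gs). j \<noteq> i \<longrightarrow> ((g # h # gs) ! i) u \<notin> path_image ((g # h # gs) ! j)"
      using IH x(3) Suc by (auto simp: nth_Cons' less_Suc_eq_0_disj)
    moreover have "0 < (1 + x) / 2 \<and> (1 + x) / 2 < 1 \<and> join_paths (g # h # gs) ((1 + x) / 2) = ((g # h # gs) ! i) u"
      using x Suc right[of x] by (simp add: J_def)
    ultimately show ?thesis by blast
  qed
qed auto

section \<open>On which side of an arc the interior lies\<close>

text \<open>The second arc completes the first to one full turn in the direction \<sigma>. At the
  centre the integrand is constant, so winding numbers are swept angles over 2 pi, and these add up
  to \<sigma>; the value is then constant on the disc, and 0 outside its closure.\<close>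

lemma winding_number_full_arc:
  fixes c w :: complex and r s t \<sigma> :: real
  assumes "0 < r" "\<sigma> = 1 \<or> \<sigma> = - 1" "w \<notin> sphere c r"
  defines "C \<equiv> part_circlepath c r s t +++ part_circlepath c r t (s + 2 * pi * \<sigma>)"
  shows "winding_number C w = (if w \<in> ball c r then of_real \<sigma> else 0)"
proof -
  have e: "exp (\<i> * (s + 2 * pi * \<sigma>)) = exp (\<i> * s)"
  proof -
    have "exp (\<i> * (s + 2 * pi * \<sigma>)) = cis s * cis (2 * pi * \<sigma>)"
      by (simp add: cis_conv_exp exp_add distrib_left)
    also have "cis (2 * pi * \<sigma>) = 1" using assms(2) by (auto simp: complex_eq_iff)
    finally show ?thesis by (simp add: cis_conv_exp)
  qed
  have arc: "path_image (part_circlepath c r a b) \<subseteq> sphere c r" for a b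
    using assms(1) by (intro path_image_part_circlepath_subset') simp
  have C: "path C" "pathfinish C = pathstart C" "path_image C \<subseteq> sphere c r"
    unfolding C_def using e arc[of s t] arc[of t "s + 2 * pi * \<sigma>"] by (auto simp: path_image_join)
  show ?thesis
  proof (cases "w \<in> ball c r")
    case True
    have cn: "c \<notin> path_image (part_circlepath c r a b)" for a b
      using arc[of a b] assms(1) by auto
    have wn: "winding_number (part_circlepath c r a b) c = of_real (b - a) / (2 * pi)" for a b
    proof -
      have "winding_number (part_circlepath c r a b) c = 1 / (2 * pi * \<i>) * contour_integral (part_circlepath c r a b) (\<lambda>w. 1 / (w - c))"
        using cn by (intro winding_number_valid_path) auto
      also have "contour_integral (part_circlepath c r a b) (\<lambda>w. 1 / (w - c)) = \<i> * (b - a)"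
      proof (rule contour_integral_unique)
        have "((\<lambda>x::real. \<i> * (b - a)) has_integral \<i> * (b - a)) {0..1}"
          using has_integral_const_real[of "\<i> * (b - a)" 0 1] by simp
        then show "((\<lambda>w. 1 / (w - c)) has_contour_integral \<i> * (b - a)) (part_circlepath c r a b)"
          unfolding has_contour_integral vector_derivative_part_circlepath
          using assms(1) by (simp add: part_circlepath_def)
      qed
      finally show ?thesis by simp
    qed
    have "winding_number C w = winding_number C c"
      using True assms(1) C by (intro winding_number_eq[of _ _ "ball c r"]) auto
    also have "\<dots> = winding_number (part_circlepath c r s t) c + winding_number (part_circlepath c r t (s + 2 * pi * \<sigma>)) c"
      unfolding C_def using cn by (intro winding_number_join) auto
    also have "\<dots> = of_real \<sigma>" unfolding wn by (simp add: field_simps)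
    finally show ?thesis using True by simp
  next
    case False
    then have "w \<notin> cball c r" using assms(3) by auto
    then have "winding_number C w = 0"
      using C by (intro winding_number_zero_outside[where s="cball c r"]) (auto simp: subset_iff)
    with False show ?thesis by simp
  qed
qed

text \<open>Near the chosen point the winding number of \<gamma> is \<open>H\<close> outside the
  circle and \<open>H\<close> + \<sigma> inside it, with \<open>H\<close> the winding number of
  everything else minus that of the complementary arc \<open>co\<close>. Both values lie in {0, 1},
  so \<sigma> = 1 forces H = 0 and \<sigma> = -1 forces H = 1.\<close>

lemma jordan_one_side_of_arc:
  fixes \<gamma> :: "real \<Rightarrow> complex"
  assumes J: "simple_path \<gamma>" "pathfinish \<gamma> = pathstart \<gamma>" "positively_oriented \<gamma>"
    and "0 < r" "s \<noteq> t" "\<bar>t - s\<bar> < 2 * pi" "u \<in> open_segment s t"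
    and "finite F" "\<And>g. g \<in> F \<Longrightarrow> path (G g)" "\<And>g. g \<in> F \<Longrightarrow> c + of_real r * cis u \<notin> path_image (G g)"
    and image: "path_image \<gamma> = path_image (part_circlepath c r s t) \<union> (\<Union>g\<in>F. path_image (G g))"
    and wind: "\<And>w. w \<notin> path_image \<gamma> \<Longrightarrow>
      winding_number \<gamma> w = winding_number (part_circlepath c r s t) w + (\<Sum>g\<in>F. winding_number (G g) w)"
  obtains d where "0 < d"
    "inside (path_image \<gamma>) \<inter> ball (c + of_real r * cis u) d \<subseteq> (if s < t then ball c r else - cball c r)"
proof -
  define p where "p = c + of_real r * cis u"
  define \<sigma> :: real where "\<sigma> = (if s < t then 1 else - 1)"
  define co where "co = part_circlepath c r t (s + 2 * pi * \<sigma>)"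
  define H where "H w = (\<Sum>g\<in>F. winding_number (G g) w) - winding_number co w" for w
  have "p \<notin> path_image co"
  proof
    assume "p \<in> path_image co"
    then obtain v where v: "v \<in> closed_segment t (s + 2 * pi * \<sigma>)" "p = c + of_real r * cis v"
      by (auto simp: co_def path_image_part_circlepath')
    then have "cis u = cis v" using \<open>0 < r\<close> by (simp add: p_def)
    then have "cis (u - v) = 1" by (simp flip: cis_divide)
    then have "cos (u - v) = 1" by (simp add: complex_eq_iff)
    then obtain k :: int where "u - v = of_int k * (2 * pi)" by (metis cos_one_2pi_int mult.assoc)
    \<comment> \<open>The angle \<open>u\<close> is strictly between \<open>s\<close> and
      \<open>t\<close>, while \<open>v\<close> runs from \<open>t\<close> on to one full turn past
      \<open>s\<close>; the gap is therefore strictly between 0 and 2 pi.\<close>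
    moreover have "u - v \<noteq> 0" "\<bar>u - v\<bar> < 2 * pi"
      using v(1) assms(5-7)
      by (auto simp: \<sigma>_def closed_segment_eq_real_ivl open_segment_eq_real_ivl split: if_splits)
    ultimately show False
      by (auto simp: abs_mult)
  qed
  have co: "path co" by (simp add: co_def)
  have "open (- (\<Union>g\<in>F. path_image (G g)))"
    using assms(8,9) by (intro open_Compl closed_UN) (auto intro: closed_path_image)
  moreover have "p \<in> - (\<Union>g\<in>F. path_image (G g))" using assms(10) by (auto simp: p_def)
  ultimately obtain d1 where d1: "0 < d1" "ball p d1 \<subseteq> - (\<Union>g\<in>F. path_image (G g))"
    by (meson open_contains_ball)
  have "open (- path_image co)" using co by (simp add: closed_path_image open_Compl)
  then obtain d3 where d3: "0 < d3" "ball p d3 \<subseteq> - path_image co"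
    using \<open>p \<notin> path_image co\<close> by (meson ComplI open_contains_ball)
  have "continuous (at p) H"
    unfolding H_def using assms(9,10) co \<open>p \<notin> path_image co\<close>
    by (intro continuous_intros continuous_at_winding_number) (auto simp: p_def)
  \<comment> \<open>The constant 1/2 puts any two nearby values of \<open>H\<close> at distance
    below 1, so integer values coincide.\<close>
  then obtain d2 where d2: "0 < d2" "\<And>w. dist w p < d2 \<Longrightarrow> dist (H w) (H p) < 1 / 2"
    unfolding continuous_at_eps_delta by (metis half_gt_zero_iff zero_less_one)
  define d where "d = min d1 (min d2 d3)"
  have "0 < d" using d1 d2 d3 by (simp add: d_def)
  have arc_sub: "path_image (part_circlepath c r s t) \<subseteq> sphere c r"
    using \<open>0 < r\<close> by (intro path_image_part_circlepath_subset') simp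
  have H_eq: "winding_number \<gamma> w = H w + (if w \<in> ball c r then of_real \<sigma> else 0)"
    and notin: "w \<notin> path_image \<gamma>"
    if w: "w \<in> ball p d" "w \<notin> sphere c r" for w
  proof -
    show notin: "w \<notin> path_image \<gamma>"
      using w arc_sub d1(2) by (auto simp: image d_def)
    have "winding_number (part_circlepath c r s t +++ co) w =
        winding_number (part_circlepath c r s t) w + winding_number co w"
      unfolding co_def using w d3(2) arc_sub by (intro winding_number_join) (auto simp: d_def co_def)
    moreover have "winding_number (part_circlepath c r s t +++ co) w = (if w \<in> ball c r then of_real \<sigma> else 0)"
      unfolding co_def by (rule winding_number_full_arc) (use w \<open>0 < r\<close> in \<open>auto simp: \<sigma>_def\<close>)
    ultimately show "winding_number \<gamma> w = H w + (if w \<in> ball c r then of_real \<sigma> else 0)"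
      using wind[OF notin] by (simp add: H_def)
  qed
  have W01: "winding_number \<gamma> w = (if w \<in> inside (path_image \<gamma>) then 1 else 0)" if "w \<notin> path_image \<gamma>" for w
  proof (cases "w \<in> inside (path_image \<gamma>)")
    case True
    with J(3) show ?thesis by (simp add: positively_oriented_def)
  next
    case False
    with that have "w \<in> outside (path_image \<gamma>)" using inside_Un_outside by blast
    with False J show ?thesis by (simp add: winding_number_zero_in_outside simple_path_imp_path)
  qed
  have H_Ints: "H w \<in> \<int>" if w: "w \<in> ball p d" "w \<notin> sphere c r" for w
  proof -
    have "H w = winding_number \<gamma> w - (if w \<in> ball c r then of_real \<sigma> else 0)"
      using H_eq[OF w] by simp
    moreover have "winding_number \<gamma> w \<in> \<int>" using W01[OF notin[OF w]] by simp
    moreover have "(of_real \<sigma> :: complex) \<in> \<int>" by (simp add: \<sigma>_def)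
    ultimately show ?thesis by simp
  qed
  have close: "H w = H w'" if "w \<in> ball p d" "w \<notin> sphere c r" "w' \<in> ball p d" "w' \<notin> sphere c r" for w w'
  proof -
    have "H w \<in> \<int>" "H w' \<in> \<int>" using H_Ints that by auto
    moreover have "dist (H w) (H w') < 1"
      using d2(2)[of w] d2(2)[of w'] that dist_triangle_half_l[of "H w" "H p" 1 "H w'"]
      by (auto simp: d_def dist_commute)
    ultimately show ?thesis
      by (auto simp: Ints_def dist_norm simp flip: of_int_diff)
  qed
  define A where "A = (if s < t then - cball c r else ball c r)"
  define B where "B = (if s < t then ball c r else - cball c r)"
  have scale: "p + of_real e * cis u \<in> (if 0 < e then - cball c r else ball c r)"
    "p + of_real e * cis u \<in> ball p d" if "e \<noteq> 0" "\<bar>e\<bar> < d" "\<bar>e\<bar> < r" for e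
  proof -
    have "p + of_real e * cis u - c = of_real (r + e) * cis u"
      by (simp add: p_def algebra_simps)
    then have "dist c (p + of_real e * cis u) = r + e"
      using that by (simp add: dist_norm norm_minus_commute[of c] norm_mult del: of_real_add)
    then show "p + of_real e * cis u \<in> (if 0 < e then - cball c r else ball c r)" using that by auto
    show "p + of_real e * cis u \<in> ball p d" using that by (simp add: dist_norm norm_mult)
  qed
  define e where "e = min d r / 2"
  have e: "0 < e" "e < d" "e < r" using \<open>0 < d\<close> \<open>0 < r\<close> by (auto simp: e_def min_def)
  obtain wi where wi: "wi \<in> ball p d" "wi \<in> ball c r"
  proof (rule that)
    show "p + of_real (- e) * cis u \<in> ball p d" using scale(2)[of "- e"] e by simp
    show "p + of_real (- e) * cis u \<in> ball c r" using scale(1)[of "- e"] e by simp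
  qed
  obtain wo where wo: "wo \<in> ball p d" "wo \<in> - cball c r"
  proof (rule that)
    show "p + of_real e * cis u \<in> ball p d" using scale(2)[of e] e by simp
    show "p + of_real e * cis u \<in> - cball c r" using scale(1)[of e] e by simp
  qed
  have Hval: "H w = (if s < t then 0 else 1)" if w: "w \<in> ball p d" "w \<notin> sphere c r" for w
  proof -
    have ns: "wi \<notin> sphere c r" "wo \<notin> sphere c r" "wo \<notin> ball c r" using wi wo by auto
    have "winding_number \<gamma> wi = H w + of_real \<sigma>" "winding_number \<gamma> wo = H w"
      \<comment> \<open>One sample point on each side of the circle determines the common value of
        \<open>H\<close>.\<close>
      using H_eq[OF wi(1) ns(1)] H_eq[OF wo(1) ns(2)] close[OF wi(1) ns(1) w] close[OF wo(1) ns(2) w] wi(2) ns(3)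
      by auto
    then show ?thesis
      using W01[OF notin[OF wi(1) ns(1)]] W01[OF notin[OF wo(1) ns(2)]]
      by (auto simp: \<sigma>_def split: if_splits)
  qed
  have A_free: "inside (path_image \<gamma>) \<inter> ball p d \<inter> A = {}"
  proof (rule ccontr)
    assume "inside (path_image \<gamma>) \<inter> ball p d \<inter> A \<noteq> {}"
    then obtain w where w: "w \<in> inside (path_image \<gamma>)" "w \<in> ball p d" "w \<in> A" by blast
    then have ns: "w \<notin> sphere c r" by (auto simp: A_def split: if_splits)
    have "winding_number \<gamma> w = 0"
      using H_eq[OF w(2) ns] Hval[OF w(2) ns] w(3) by (auto simp: A_def \<sigma>_def split: if_splits)
    then show False using W01[OF notin[OF w(2) ns]] w(1) by simp
  qed
  \<comment> \<open>Points on the circle itself remain to be excluded: an open set that misses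
    \<open>A\<close> also misses its closure.\<close>
  have "open (inside (path_image \<gamma>) \<inter> ball p d)"
    using Jordan_inside_outside[OF J(1,2)] by auto
  then have "inside (path_image \<gamma>) \<inter> ball p d \<inter> closure A = {}"
    using A_free open_Int_closure_eq_empty by blast
  moreover have "- closure A = B"
    using \<open>0 < r\<close> by (simp add: A_def B_def closure_complement)
  ultimately have "inside (path_image \<gamma>) \<inter> ball p d \<subseteq> B" by blast
  with that[of d] \<open>0 < d\<close> show ?thesis by (simp add: p_def B_def)
qed

section \<open>Polygons\<close>

lemma sum_over_sides:
  "(\<Sum>g\<leftarrow>map (\<lambda>k. f (S k)) [1..<n + 1]. h g) = (\<Sum>k=1..n. h (f (S k)))"
proof -
  have "(\<Sum>g\<leftarrow>map (\<lambda>k. f (S k)) [1..<n + 1]. h g) = sum_list (map (\<lambda>k. h (f (S k))) [1..<n + 1])"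
    by (simp add: o_def)
  also have "\<dots> = (\<Sum>k=1..n. h (f (S k)))"
    by (simp only: sum_set_upt_conv_sum_list_nat[symmetric] set_upt atLeastLessThanSuc_atLeastAtMost Suc_eq_plus1[symmetric])
  finally show ?thesis .
qed

locale hyperbolic_ngon =
  fixes n :: nat and z :: "nat \<Rightarrow> complex" and S :: "nat \<Rightarrow> side"
  assumes n3: "n \<ge> 3" and poly: "hyperbolic_polygon n z S"
    and oriented: "positively_oriented (boundary_curve n S)"
begin

definition sides :: "(real \<Rightarrow> complex) list" where
  "sides = map (\<lambda>k. side_path (S k)) [1..<n + 1]"

abbreviation "\<gamma> \<equiv> boundary_curve n S"
abbreviation "P \<equiv> polygon_region n S"

lemma boundary_join: "\<gamma> = join_paths sides"
  by (simp only: boundary_curve_def sides_def)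

lemma sides_nth: "i < n \<Longrightarrow> sides ! i = side_path (S (Suc i))"
  by (simp add: sides_def del: upt_Suc)

lemma length_sides: "length sides = n"
  by (simp add: sides_def)

lemma set_sides: "set sides = (\<lambda>k. side_path (S k)) ` {1..n}"
  by (simp add: sides_def atLeastLessThanSuc_atLeastAtMost del: upt_Suc)

lemma side_geodesic:
  assumes "k \<in> {1..n}"
  shows "is_geodesic (S k) (z k) (z (k + 1))" "z k \<noteq> z (k + 1)" "cmod (z k) \<le> 1" "cmod (z (k + 1)) \<le> 1"
proof -
  show "is_geodesic (S k) (z k) (z (k + 1))" "z k \<noteq> z (k + 1)" "cmod (z k) \<le> 1"
    using poly assms by (auto simp: hyperbolic_polygon_def)
  \<comment> \<open>The disc condition is given for indices up to \<open>n\<close> only; index n + 1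
    wraps around to 1.\<close>
  have "k + 1 \<in> {1..n} \<or> z (k + 1) = z 1"
    using poly assms by (cases "k = n") (auto simp: hyperbolic_polygon_def)
  moreover have "1 \<in> {1..n}" using n3 by simp
  ultimately show "cmod (z (k + 1)) \<le> 1"
    using poly by (auto simp: hyperbolic_polygon_def)
qed

lemma geodesic_ends:
  assumes "is_geodesic T p q" shows "pathstart (side_path T) = p" "pathfinish (side_path T) = q"
  using assms by (cases T; simp)+

lemma sides_ok: "sides \<noteq> []" "\<forall>g\<in>set sides. path g" "successively (\<lambda>g h. pathfinish g = pathstart h) sides"
proof -
  show "sides \<noteq> []" using n3 length_sides by auto
  show "\<forall>g\<in>set sides. path g" by (auto simp: set_sides)
  show "successively (\<lambda>g h. pathfinish g = pathstart h) sides"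
    unfolding successively_conv_nth length_sides
  proof (intro allI impI)
    fix i assume "Suc i < n"
    then show "pathfinish (sides ! i) = pathstart (sides ! Suc i)"
      using geodesic_ends(2)[OF side_geodesic(1)[of "Suc i"]] geodesic_ends(1)[OF side_geodesic(1)[of "Suc (Suc i)"]]
      by (simp add: sides_nth)
  qed
qed

lemma path_image_boundary: "path_image \<gamma> = (\<Union>k\<in>{1..n}. path_image (side_path (S k)))"
  unfolding boundary_join using join_paths_path[OF sides_ok] by (simp add: set_sides)

lemma winding_number_boundary:
  assumes "w \<notin> path_image \<gamma>"
  shows "winding_number \<gamma> w = (\<Sum>k=1..n. winding_number (side_path (S k)) w)"
proof -
  have "winding_number (join_paths sides) w = (\<Sum>g\<leftarrow>sides. winding_number g w)"
    using assms by (intro winding_number_join_paths sides_ok) (auto simp: path_image_boundary set_sides)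
  then show ?thesis
    unfolding boundary_curve_def sides_def sum_over_sides .
qed

lemma boundary_simple: "simple_path \<gamma>" "pathfinish \<gamma> = pathstart \<gamma>"
  using poly by (auto simp: hyperbolic_polygon_def)

lemma side_in_disc: "k \<in> {1..n} \<Longrightarrow> path_image (side_path (S k)) \<subseteq> cball 0 1"
  using geodesic_side_basics(2)[OF side_geodesic] by (auto simp: path_image_def)

lemma open_region: "open P"
  using Jordan_inside_outside[OF boundary_simple] by (simp add: polygon_region_def)

text \<open>The complement of the closed disc lies in the outside of the boundary by convexity, and
  an open subset of the closed disc lies in the open disc. The density is thus continuous on the
  region.\<close>

lemma region_in_disc: "P \<subseteq> ball 0 1"
proof -
  have "path_image \<gamma> \<subseteq> cball 0 1" unfolding path_image_boundary using side_in_disc by (rule UN_least)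
  then have "P \<subseteq> cball 0 1"
    unfolding polygon_region_def
    by (meson convex_cball convex_in_outside disjoint_iff inside_Int_outside outside_mono subsetD subsetI)
  then have "P \<subseteq> interior (cball 0 1)" using open_region by (rule interior_maximal)
  then show ?thesis by simp
qed

section \<open>The area as a sum of side contributions\<close>

lemma winding_number_region:
  assumes "w \<notin> path_image \<gamma>"
  shows "winding_number \<gamma> w = indicator P w"
proof (cases "w \<in> P")
  case True
  then show ?thesis using oriented by (simp add: positively_oriented_def polygon_region_def)
next
  case False
  moreover have "w \<in> inside (path_image \<gamma>) \<union> outside (path_image \<gamma>)"
    using assms unfolding inside_Un_outside by simp
  ultimately have "w \<in> outside (path_image \<gamma>)" unfolding polygon_region_def by blast
  then show ?thesis using False boundary_simple
    by (simp add: winding_number_zero_in_outside simple_path_imp_path)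
qed

text \<open>Almost every \<open>w\<close> lies off all sides, and there the indicator of the region
  is the sum of the winding integrals \<open>W k w\<close> divided by 2 pi i; the Cauchy transform
  then evaluates each summand as a line integral \<open>V k\<close>.\<close>

lemma truncated_area:
  assumes R: "0 < R" "R < 1"
  shows "integrable lborel (\<lambda>w. truncated_density R w * indicator P w)"
    and "(LINT w|lborel. truncated_density R w * indicator P w) =
      (\<Sum>k=1..n. truncated_side_integral R (S k))"
proof -
  define W where "W k w = (LINT t:{0..1}|lborel. side_velocity (S k) t / (side_path (S k) t - w))" for k w
  define V where "V k = (LINT t:{0..1}|lborel. side_velocity (S k) t * (disc_mass (min (cmod (side_path (S k) t)) R) / side_path (S k) t))" for k
  have side: "integrable lborel (\<lambda>w. truncated_density R w * W k w)"
      "(LINT w|lborel. truncated_density R w * W k w) = V k" if k: "k \<in> {1..n}" for k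
    unfolding W_def V_def
    using geodesic_side_basics[OF side_geodesic[OF k]]
    by (intro cauchy_transform_of_path[OF R] continuous_on_side_path continuous_on_side_velocity; simp)+
  have AE: "AE w in lborel. complex_of_real (truncated_density R w * indicator P w) =
      (\<Sum>k=1..n. truncated_density R w * W k w) / (2 * pi * \<i>)"
  proof -
    have "AE w in lborel. \<forall>k\<in>{1..n}. w \<notin> path_image (side_path (S k))"
      by (rule AE_finite_allI) (auto intro: AE_not_on_side)
    then show ?thesis
    proof eventually_elim
      case (elim w)
      then have nw: "w \<notin> path_image \<gamma>" by (auto simp: path_image_boundary)
      have wk: "winding_number (side_path (S k)) w = W k w / (2 * pi * \<i>)" if "k \<in> {1..n}" for k
        unfolding W_def using elim that
        by (intro winding_number_set_integral valid_path_side has_vector_derivative_side continuous_on_side_velocity) auto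
      have "complex_of_real (indicator P w) = (\<Sum>k=1..n. winding_number (side_path (S k)) w)"
        using winding_number_region[OF nw] winding_number_boundary[OF nw] by (simp add: indicator_def)
      also have "\<dots> = (\<Sum>k=1..n. W k w) / (2 * pi * \<i>)"
        by (simp add: wk sum_divide_distrib)
      finally have i: "complex_of_real (indicator P w) = (\<Sum>k=1..n. W k w) / (2 * pi * \<i>)" .
      show ?case unfolding of_real_mult i by (simp add: sum_distrib_left)
    qed
  qed
  have meas: "(\<lambda>w. truncated_density R w * indicator P w) \<in> borel_measurable lborel"
    using open_region by (intro borel_measurable_times borel_measurable_indicator) (auto simp: measurable_truncated_density)
  have measc: "(\<lambda>w. complex_of_real (truncated_density R w * indicator P w)) \<in> borel_measurable lborel"
    by (rule measurable_compose[OF meas borel_measurable_of_real])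
  have int: "integrable lborel (\<lambda>w. (\<Sum>k=1..n. truncated_density R w * W k w) / (2 * pi * \<i>))"
    by (intro integrable_divide_zero Bochner_Integration.integrable_sum side)
  have intc: "integrable lborel (\<lambda>w. complex_of_real (truncated_density R w * indicator P w))"
  proof (rule integrable_cong_AE_imp[OF int measc])
    show "AE w in lborel. (\<Sum>k=1..n. truncated_density R w * W k w) / (2 * pi * \<i>) =
        complex_of_real (truncated_density R w * indicator P w)"
      using AE by eventually_elim (rule sym)
  qed
  then show "integrable lborel (\<lambda>w. truncated_density R w * indicator P w)"
    using complex_of_real_integrable_eq by blast
  have sumV: "(LINT w|lborel. (\<Sum>k=1..n. truncated_density R w * W k w)) = (\<Sum>k=1..n. V k)"
  proof -
    have "(LINT w|lborel. (\<Sum>k=1..n. truncated_density R w * W k w)) =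
        (\<Sum>k=1..n. (LINT w|lborel. truncated_density R w * W k w))"
      by (rule Bochner_Integration.integral_sum) (rule side(1))
    also have "\<dots> = (\<Sum>k=1..n. V k)" by (intro sum.cong refl side(2))
    finally show ?thesis .
  qed
  have "complex_of_real (LINT w|lborel. truncated_density R w * indicator P w) =
      (LINT w|lborel. complex_of_real (truncated_density R w * indicator P w))"
    by (rule integral_complex_of_real[symmetric])
  also have "\<dots> = (LINT w|lborel. (\<Sum>k=1..n. truncated_density R w * W k w) / (2 * pi * \<i>))"
    by (rule integral_cong_AE[OF measc borel_measurable_integrable[OF int] AE])
  also have "\<dots> = (\<Sum>k=1..n. V k) / (2 * pi * \<i>)"
    by (simp only: integral_divide_zero sumV)
  also have "\<dots> = (\<Sum>k=1..n. V k / (2 * pi * \<i>))" by (rule sum_divide_distrib)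
  \<comment> \<open>Only the total is known to be real. Passing to real parts keeps Im (dz / z) on
    each side and discards the radial part of dz / z.\<close>
  finally have "(LINT w|lborel. truncated_density R w * indicator P w) = Re (\<Sum>k=1..n. V k / (2 * pi * \<i>))"
    by (metis Re_complex_of_real)
  also have "\<dots> = (\<Sum>k=1..n. Re (V k / (2 * pi * \<i>)))" by (rule Re_sum)
  also have "\<dots> = (\<Sum>k=1..n. truncated_side_integral R (S k))"
  proof (rule sum.cong)
    fix k assume k: "k \<in> {1..n}"
    define f where "f t = side_velocity (S k) t * (disc_mass (min (cmod (side_path (S k) t)) R) / side_path (S k) t)" for t
    have V: "V k = (LINT t|lborel. indicator {0..1} t *\<^sub>R f t)" by (simp add: V_def f_def set_lebesgue_integral_def)
    have "integrable lborel (\<lambda>t. indicator {0..1} t *\<^sub>R f t)"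
      unfolding f_def
      using geodesic_side_basics[OF side_geodesic[OF k]]
      by (intro cauchy_transform_of_path(3)[OF R, unfolded set_integrable_def] continuous_on_side_path continuous_on_side_velocity)
    then have int: "integrable lborel (\<lambda>t. (indicator {0..1} t *\<^sub>R f t) / (2 * pi * \<i>))"
      by (intro integrable_divide_zero)
    have "Re (V k / (2 * pi * \<i>)) = (LINT t|lborel. Re ((indicator {0..1} t *\<^sub>R f t) / (2 * pi * \<i>)))"
      unfolding V integral_Re[OF int] integral_divide_zero ..
    also have "\<dots> = truncated_side_integral R (S k)"
      unfolding truncated_side_integral_def set_lebesgue_integral_def
    proof (intro Bochner_Integration.integral_cong refl)
      fix t
      have re: "Re (x / (2 * pi * \<i>)) = Im x / (2 * pi)" for x
        by (simp add: Re_divide power2_eq_square)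
      have im: "Im (a *\<^sub>R x) = a * Im x" for a x by simp
      have "f t = disc_mass (min (cmod (side_path (S k) t)) R) *\<^sub>R (side_velocity (S k) t / side_path (S k) t)"
        by (simp add: f_def scaleR_conv_of_real)
      then show "Re ((indicator {0..1} t *\<^sub>R f t) / (2 * pi * \<i>)) = indicator {0..1} t *\<^sub>R
         (Im (side_velocity (S k) t / side_path (S k) t) * disc_mass (min (cmod (side_path (S k) t)) R) / (2 * pi))"
        by (simp only: re im) (simp only: real_scaleR_def times_divide_eq_right mult.commute)
    qed
    finally show "Re (V k / (2 * pi * \<i>)) = truncated_side_integral R (S k)" .
  qed simp
  finally show "(LINT w|lborel. truncated_density R w * indicator P w) =
      (\<Sum>k=1..n. truncated_side_integral R (S k))" .
qed

text \<open>The truncated integrals increase with \<open>R\<close>, and their values converge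
  because the side contributions do. Monotone convergence therefore yields integrability and the
  value together, including for regions that reach the unit circle.\<close>

lemma hyperbolic_area_turns:
  "set_integrable lborel P hyperbolic_density" "hyperbolic_area P = (\<Sum>k=1..n. side_turn (S k))"
proof -
  \<comment> \<open>The double successor gives \<open>R 0 = 1 / 2\<close>, so that every radius is
    positive.\<close>
  define R :: "nat \<Rightarrow> real" where "R j = 1 - inverse (real (Suc (Suc j)))" for j
  have R: "0 < R j \<and> R j < 1" for j by (simp add: R_def divide_simps)
  have "R \<longlonglongrightarrow> 1" unfolding R_def
    using tendsto_diff[OF tendsto_const LIMSEQ_Suc[OF LIMSEQ_inverse_real_of_nat], of 1] by simp
  have "incseq R" unfolding R_def by (intro incseq_SucI diff_left_mono le_imp_inverse_le) auto
  have "has_bochner_integral lborel (\<lambda>w. hyperbolic_density w * indicator P w) (\<Sum>k=1..n. side_turn (S k))"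
  proof (rule has_bochner_integral_monotone_convergence)
    show "integrable lborel (\<lambda>w. truncated_density (R j) w * indicator P w)" for j
      using R[of j] truncated_area(1) by blast
    show "AE w in lborel. mono (\<lambda>j. truncated_density (R j) w * indicator P w)"
    proof (rule AE_I2, rule monoI)
      fix w :: complex and i j :: nat assume "i \<le> j"
      then have "R i \<le> R j" using \<open>incseq R\<close> by (rule incseqD[rotated])
      then show "truncated_density (R i) w * indicator P w \<le> truncated_density (R j) w * indicator P w"
        by (auto simp: truncated_density_def indicator_def)
    qed
    show "AE w in lborel. (\<lambda>j. truncated_density (R j) w * indicator P w) \<longlonglongrightarrow> hyperbolic_density w * indicator P w"
    proof (rule AE_I2)
      fix w :: complex
      show "(\<lambda>j. truncated_density (R j) w * indicator P w) \<longlonglongrightarrow> hyperbolic_density w * indicator P w"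
      proof (cases "w \<in> P")
        case True
        then have "cmod w < 1" using region_in_disc by auto
        then have "\<forall>\<^sub>F j in sequentially. cmod w < R j"
          using \<open>R \<longlonglongrightarrow> 1\<close> by (intro order_tendstoD(1)) auto
        then have "\<forall>\<^sub>F j in sequentially. truncated_density (R j) w * indicator P w = hyperbolic_density w * indicator P w"
          by eventually_elim (simp add: truncated_density_def)
        then show ?thesis by (rule tendsto_eventually)
      qed simp
    qed
    have "(\<lambda>j. \<Sum>k=1..n. truncated_side_integral (R j) (S k)) \<longlonglongrightarrow> (\<Sum>k=1..n. side_turn (S k))"
      using side_geodesic R \<open>R \<longlonglongrightarrow> 1\<close> by (intro tendsto_sum truncated_side_integral_tendsto) auto
    moreover have "(LINT w|lborel. truncated_density (R j) w * indicator P w) = (\<Sum>k=1..n. truncated_side_integral (R j) (S k))" for j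
      using R[of j] truncated_area(2) by blast
    ultimately show "(\<lambda>j. LINT w|lborel. truncated_density (R j) w * indicator P w) \<longlonglongrightarrow> (\<Sum>k=1..n. side_turn (S k))"
      by simp
    show "(\<lambda>w. hyperbolic_density w * indicator P w) \<in> borel_measurable lborel"
      using open_region by (intro borel_measurable_times borel_measurable_indicator) (auto simp: measurable_hyperbolic_density)
  qed
  then show "set_integrable lborel P hyperbolic_density" "hyperbolic_area P = (\<Sum>k=1..n. side_turn (S k))"
    by (auto simp: set_integrable_def hyperbolic_area_def set_lebesgue_integral_def has_bochner_integral_iff mult.commute)
qed

section \<open>Inward and outward sides\<close>

text \<open>At each relative interior point only this side is present, by simplicity of the
  boundary, so the local one-sidedness applies; the union of the resulting balls is the required
  neighbourhood.\<close>

lemma arc_side: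
  assumes k: "k \<in> {1..n}" and S: "S k = Arc c r s t"
  shows "\<exists>U. open U \<and> rel_interior_side (S k) \<subseteq> U \<and> P \<inter> U \<subseteq> (if s < t then ball c r else - cball c r)"
proof -
  note arc = geodesic_arc[OF side_geodesic(1)[OF k, unfolded S] side_geodesic(2)[OF k]]
  have local: "\<exists>d>0. P \<inter> ball p d \<subseteq> (if s < t then ball c r else - cball c r)"
    if p: "p \<in> rel_interior_side (S k)" for p
  proof -
    obtain x where x: "0 \<le> x" "x \<le> 1" "p = side_path (S k) x" 
      using p by (auto simp: rel_interior_side_def path_image_def)
    with p have "x \<noteq> 0" "x \<noteq> 1" by (auto simp: rel_interior_side_def pathstart_def pathfinish_def)
    with x have x01: "0 < x" "x < 1" by auto
    define u where "u = linepath s t x"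
    have u: "u \<in> open_segment s t" using x01 arc(3) by (auto simp: u_def in_segment linepath_def)
    have pu: "p = c + of_real r * cis u" by (simp add: x S part_circlepath_def cis_conv_exp u_def)
    have disj: "p \<notin> path_image (side_path (S j))" if j: "j \<in> {1..n} - {k}" for j
    proof -
      \<comment> \<open>Loop-freeness permits only the coincidence of parameters 0 and 1, which
        \<open>0 < x\<close> and \<open>x < 1\<close> rule out.\<close>
      have inj: "x = y" if "0 < x" "x < 1" "0 \<le> y" "y \<le> 1" "join_paths sides x = join_paths sides y" for x y
      proof -
        have "x \<in> {0..1}" "y \<in> {0..1}" using that by auto
        then have "x = y \<or> x = 0 \<and> y = 1 \<or> x = 1 \<and> y = 0"
          using boundary_simple(1)[unfolded boundary_join simple_path_def loop_free_def] that(5) by blast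
        with that show ?thesis by auto
      qed
      \<comment> \<open>Lists count from 0 and sides from 1, so side \<open>k\<close> is entry
        \<open>k - 1\<close>.\<close>
      have k': "k - 1 < length sides" using k by (auto simp: length_sides)
      obtain j' where j': "j = Suc j'" "j' < length sides" "j' \<noteq> k - 1"
        using j k by (cases j) (auto simp: length_sides)
      have "(sides ! (k - 1)) x \<notin> path_image (sides ! j')"
        using join_paths_disjoint[OF sides_ok inj k' x01] j' by blast
      moreover have "sides ! (k - 1) = side_path (S k)" "sides ! j' = side_path (S j)"
        using k j' by (auto simp: sides_nth length_sides)
      ultimately show ?thesis using x by simp
    qed
    obtain d where "0 < d" "inside (path_image \<gamma>) \<inter> ball (c + of_real r * cis u) d \<subseteq> (if s < t then ball c r else - cball c r)"
    proof (rule jordan_one_side_of_arc[of \<gamma> r s t u "{1..n} - {k}" "\<lambda>j. side_path (S j)" c])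
      show "path_image \<gamma> = path_image (part_circlepath c r s t) \<union> (\<Union>g\<in>{1..n} - {k}. path_image (side_path (S g)))"
      proof -
        have "(\<Union>g\<in>insert k ({1..n} - {k}). path_image (side_path (S g))) =
            path_image (side_path (S k)) \<union> (\<Union>g\<in>{1..n} - {k}. path_image (side_path (S g)))"
          by (rule UN_insert)
        then show ?thesis unfolding path_image_boundary insert_Diff[OF k] by (simp only: S side_path.simps)
      qed
      show "winding_number \<gamma> w = winding_number (part_circlepath c r s t) w + (\<Sum>g\<in>{1..n} - {k}. winding_number (side_path (S g)) w)"
        if "w \<notin> path_image \<gamma>" for w
        unfolding winding_number_boundary[OF that] using k by (subst sum.remove[of _ k]) (auto simp: S)
      show "\<bar>t - s\<bar> < 2 * pi" using arc(4) by simp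
      show "c + of_real r * cis u \<notin> path_image (side_path (S g))" if "g \<in> {1..n} - {k}" for g
        using disj[OF that] by (simp add: pu)
    qed (use boundary_simple oriented arc u in auto)
    then show ?thesis by (auto simp: pu polygon_region_def)
  qed
  have "\<exists>d. \<forall>p\<in>rel_interior_side (S k). 0 < d p \<and> P \<inter> ball p (d p) \<subseteq> (if s < t then ball c r else - cball c r)"
    by (rule bchoice) (use local in blast)
  then obtain d where d: "\<forall>p\<in>rel_interior_side (S k). 0 < d p \<and> P \<inter> ball p (d p) \<subseteq> (if s < t then ball c r else - cball c r)"
    by (rule exE)
  show ?thesis
  proof (intro exI conjI)
    show "open (\<Union>p\<in>rel_interior_side (S k). ball p (d p))" by blast
    show "rel_interior_side (S k) \<subseteq> (\<Union>p\<in>rel_interior_side (S k). ball p (d p))"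
      using d by fastforce
    show "P \<inter> (\<Union>p\<in>rel_interior_side (S k). ball p (d p)) \<subseteq> (if s < t then ball c r else - cball c r)"
      using d by blast
  qed
qed

text \<open>The direction of traversal gives one implication in each case. The converses follow
  because a side cannot be both: by the Jordan curve theorem each of its points is a limit of points
  of the region, which would have to lie inside and outside the circle at once.\<close>

lemma inward_outward_arc:
  assumes k: "k \<in> {1..n}" and S: "S k = Arc c r s t"
  shows "inward P (S k) \<longleftrightarrow> t < s" "outward P (S k) \<longleftrightarrow> s < t"
proof -
  note arc = geodesic_arc[OF side_geodesic(1)[OF k, unfolded S] side_geodesic(2)[OF k]]
  have not_both: False if io: "inward P (S k)" "outward P (S k)"
  proof -
    obtain U where U: "open U \<and> rel_interior_side (S k) \<subseteq> U \<and> P \<inter> U \<subseteq> - cball c r"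
      using io(1) unfolding S inward.simps by (rule exE)
    obtain V where V: "open V \<and> rel_interior_side (S k) \<subseteq> V \<and> P \<inter> V \<subseteq> ball c r"
      using io(2) unfolding S outward.simps by (rule exE)
    \<comment> \<open>The parameter 1/2 merely exhibits a point of the relative interior.\<close>
    define p where "p = side_path (S k) (1 / 2)"
    have "arc (part_circlepath c r s t)" using arc by (intro arc_part_circlepath) auto
    then have inj: "inj_on (side_path (S k)) {0..1}" by (simp add: S arc_def)
    have "p \<noteq> side_path (S k) 0" "p \<noteq> side_path (S k) 1"
      using inj_onD[OF inj, of "1/2" 0] inj_onD[OF inj, of "1/2" 1] by (auto simp: p_def)
    then have p: "p \<in> rel_interior_side (S k)"
      by (auto simp: rel_interior_side_def path_image_def pathstart_def pathfinish_def p_def)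
    then have "p \<in> path_image \<gamma>" using k by (auto simp: path_image_boundary rel_interior_side_def)
    moreover have "frontier P = path_image \<gamma>"
      using Jordan_inside_outside[OF boundary_simple] unfolding polygon_region_def by blast
    ultimately have "p \<in> closure P" unfolding frontier_def by blast
    moreover have "open (U \<inter> V)" "p \<in> U \<inter> V" using U V p by auto
    ultimately have "U \<inter> V \<inter> P \<noteq> {}" using open_Int_closure_eq_empty[of "U \<inter> V" P] by blast
    then obtain w where "w \<in> U" "w \<in> V" "w \<in> P" by blast
    then have "w \<in> - cball c r" "w \<in> ball c r" using U V by blast+
    then show False by simp
  qed
  have "outward P (S k)" if "s < t"
    using arc_side[OF k S] that unfolding S outward.simps by simp
  moreover have "inward P (S k)" if "t < s"
    using arc_side[OF k S] that unfolding S inward.simps by simp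
  moreover have "s < t \<or> t < s" using arc(3) by linarith
  ultimately show "inward P (S k) \<longleftrightarrow> t < s" "outward P (S k) \<longleftrightarrow> s < t"
    using not_both by (meson less_asym)+
qed

text \<open>Arcs are sorted by the sign of s - t, which is also the sign of their turn; a segment
  falls into \<open>J\<close> and contributes 0.\<close>

lemma sides_dichotomy:
  defines "I \<equiv> {k \<in> {1..n}. inward P (S k)}" and "J \<equiv> {k \<in> {1..n}. outward P (S k)}"
  shows "card I + card J = n"
    and "(\<Sum>k\<in>I. angle_measure (S k)) - (\<Sum>k\<in>J. angle_measure (S k)) = (\<Sum>k=1..n. side_turn (S k))"
proof -
  have k: "(k \<in> J \<longleftrightarrow> k \<notin> I) \<and> side_turn (S k) = (if k \<in> I then angle_measure (S k) else - angle_measure (S k))"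
    if "k \<in> {1..n}" for k
  proof (cases "S k")
    case (Segment a b)
    with that show ?thesis by (simp add: I_def J_def)
  next
    case (Arc c r s t)
    then show ?thesis
      using inward_outward_arc[OF that Arc] geodesic_arc(3)[OF side_geodesic(1)[OF that, unfolded Arc] side_geodesic(2)[OF that]] that
      by (auto simp: I_def J_def)
  qed
  have sub: "I \<subseteq> {1..n}" "J \<subseteq> {1..n}" by (auto simp: I_def J_def)
  have IJ: "{1..n} = I \<union> J" "I \<inter> J = {}" using k sub by blast+
  have fin: "finite I" "finite J" using sub finite_subset by blast+
  with IJ show "card I + card J = n"
    using card_Un_disjoint[of I J] by (simp flip: IJ(1))
  have "(\<Sum>k=1..n. side_turn (S k)) = (\<Sum>k\<in>I. side_turn (S k)) + (\<Sum>k\<in>J. side_turn (S k))"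
    unfolding IJ(1) by (rule sum.union_disjoint) (use IJ fin in auto)
  also have "(\<Sum>k\<in>I. side_turn (S k)) = (\<Sum>k\<in>I. angle_measure (S k))"
  proof (intro sum.cong refl)
    fix i assume i: "i \<in> I"
    then have "i \<in> {1..n}" by (simp add: I_def)
    from k[OF this] i show "side_turn (S i) = angle_measure (S i)" by simp
  qed
  also have "(\<Sum>k\<in>J. side_turn (S k)) = (\<Sum>k\<in>J. - angle_measure (S k))"
  proof (intro sum.cong refl)
    fix i assume i: "i \<in> J"
    then have "i \<in> {1..n}" by (simp add: J_def)
    from k[OF this] i show "side_turn (S i) = - angle_measure (S i)" by simp
  qed
  finally show "(\<Sum>k\<in>I. angle_measure (S k)) - (\<Sum>k\<in>J. angle_measure (S k)) = (\<Sum>k=1..n. side_turn (S k))"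
    by (simp add: sum_negf)
qed

end

theorem mainTheorem3:
  fixes n :: nat and z :: "nat \<Rightarrow> complex" and S :: "nat \<Rightarrow> side"
  assumes "n \<ge> 3"
    and "hyperbolic_polygon n z S"
    and "positively_oriented (boundary_curve n S)"
  defines "P \<equiv> polygon_region n S"
  defines "I \<equiv> {k \<in> {1..n}. inward P (S k)}"
  defines "J \<equiv> {k \<in> {1..n}. outward P (S k)}"
  shows "set_integrable lborel P hyperbolic_density \<and>
    (card I + card J = n \<and>
     hyperbolic_area P = (\<Sum>k\<in>I. angle_measure (S k)) - (\<Sum>k\<in>J. angle_measure (S k))) \<and>
    hyperbolic_area P =
      (\<Sum>k = 1..n. 2 * arctan ((Re (z k) * Im (z (k + 1)) - Im (z k) * Re (z (k + 1))) /
        (1 - Re (z k) * Re (z (k + 1)) - Im (z k) * Im (z (k + 1)))))"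
proof -
  interpret hyperbolic_ngon n z S
    using assms(1-3) by unfold_locales
  have "(\<Sum>k = 1..n. 2 * arctan ((Re (z k) * Im (z (k + 1)) - Im (z k) * Re (z (k + 1))) /
        (1 - Re (z k) * Re (z (k + 1)) - Im (z k) * Im (z (k + 1))))) = (\<Sum>k=1..n. side_turn (S k))"
    by (intro sum.cong refl arctan_geodesic side_geodesic)
  then show ?thesis
    using hyperbolic_area_turns sides_dichotomy by (simp add: P_def I_def J_def)
qed

end
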